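(* Fix an arbitrary $\epsilon>0$. Let $P_n$ be a random school choice problem of size $n$. With probability tending to $1$ as $n\to\infty$, every cycle packing $H$ of the envy digraph $G^{\mathrm{DA}(P_n)}$ satisfies $|V(H)|\ge(1-\epsilon)n$.
   Context: A random school choice problem $P_n$ of size $n$ has a set $I$ of $n$ students and a set $S$ of $n$ schools, each with quota 1; each student's strict preference over $S$ and each school's strict priority over $I$ are uniformly random linear orders, all mutually independent. $\mathrm{DA}(P_n)$ is the matching produced by student-proposing deferred acceptance (each unheld student applies to her most preferred school not yet rejecting her; each school tentatively holds its highest-priority applicant and rejects the others; stop when no new rejection occurs). The envy digraph $G^{\mathrm{DA}(P_n)}$ has vertex set $I$ and a directed edge $(i,j)$ iff $i$ strictly prefers $\mathrm{DA}_j(P_n)$ to $\mathrm{DA}_i(P_n)$. A cycle packing $H$ of a digraph $G$ is a union of pairwise vertex-disjoint directed cycles of $G$ (each cycle visiting distinct vertices) such that the subgraph of $G$ induced on the vertices not covered by $H$ contains no directed cycle; $V(H)$ denotes the set of vertices covered by the cycles of $H$. *)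

theory Defs
  imports "HOL-Analysis.Analysis" "HOL-Combinatorics.Multiset_Permutations"
begin

text \<open>A strict linear order on a finite set is represented by a list (a permutation of the set),
  listed from most preferred to least preferred. \<open>prefers xs a b\<close>: a is strictly ranked above b.\<close>
definition prefers :: "nat list \<Rightarrow> nat \<Rightarrow> nat \<Rightarrow> bool" where
  "prefers xs a b \<longleftrightarrow> (\<exists>i<length xs. \<exists>j<length xs. i < j \<and> xs ! i = a \<and> xs ! j = b)"

text \<open>A school choice problem of size n: students and schools are both {0..<n}, quotas 1.
  The first component lists the students' preferences over schools, the second the schools'
  priorities over students.\<close>
type_synonym problem = "nat list list \<times> nat list list"

definition problems :: "nat \<Rightarrow> problem set" where
  "problems n = {(sp, sc).
      length sp = n \<and> set sp \<subseteq> permutations_of_set {0..<n} \<and>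
      length sc = n \<and> set sc \<subseteq> permutations_of_set {0..<n}}"

text \<open>Deferred acceptance state: number of rejections each student has received so far;
  student i currently applies to the school at position \<open>k i\<close> of her list.\<close>
definition da_applies :: "problem \<Rightarrow> (nat \<Rightarrow> nat) \<Rightarrow> nat \<Rightarrow> nat" where
  "da_applies P k i = (fst P ! i) ! (k i)"

definition da_rejected :: "nat \<Rightarrow> problem \<Rightarrow> (nat \<Rightarrow> nat) \<Rightarrow> nat \<Rightarrow> bool" where
  "da_rejected n P k i \<longleftrightarrow> (\<exists>j<n. j \<noteq> i \<and> da_applies P k j = da_applies P k i \<and>
       prefers (snd P ! da_applies P k i) j i)"

text \<open>One round: every student applies to her best school not yet rejecting her (held students
  re-apply to the school holding them); each school keeps its highest-priority applicant and
  rejects the others. At a fixpoint (no new rejection) the step is the identity.\<close>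
definition da_step :: "nat \<Rightarrow> problem \<Rightarrow> (nat \<Rightarrow> nat) \<Rightarrow> (nat \<Rightarrow> nat)" where
  "da_step n P k = (\<lambda>i. if i < n \<and> da_rejected n P k i then Suc (k i) else k i)"

text \<open>Each non-terminal round produces at least one rejection and there are at most n*n
  rejections in total, so n*n rounds reach the terminal state.\<close>
definition DA :: "nat \<Rightarrow> problem \<Rightarrow> nat \<Rightarrow> nat" where
  "DA n P = da_applies P ((da_step n P ^^ (n * n)) (\<lambda>_. 0))"

definition envy :: "nat \<Rightarrow> problem \<Rightarrow> nat \<Rightarrow> nat \<Rightarrow> bool" where
  "envy n P i j \<longleftrightarrow> i < n \<and> j < n \<and> prefers (fst P ! i) (DA n P j) (DA n P i)"

definition is_cycle :: "nat set \<Rightarrow> (nat \<Rightarrow> nat \<Rightarrow> bool) \<Rightarrow> nat list \<Rightarrow> bool" where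
  "is_cycle V E c \<longleftrightarrow> c \<noteq> [] \<and> distinct c \<and> set c \<subseteq> V \<and>
     (\<forall>k < length c. E (c ! k) (c ! ((k + 1) mod length c)))"

definition has_cycle :: "nat set \<Rightarrow> (nat \<Rightarrow> nat \<Rightarrow> bool) \<Rightarrow> bool" where
  "has_cycle V E \<longleftrightarrow> (\<exists>c. is_cycle V E c)"

definition cover :: "nat list set \<Rightarrow> nat set" where
  "cover H = (\<Union>c\<in>H. set c)"

definition cycle_packing :: "nat set \<Rightarrow> (nat \<Rightarrow> nat \<Rightarrow> bool) \<Rightarrow> nat list set \<Rightarrow> bool" where
  "cycle_packing V E H \<longleftrightarrow>
     (\<forall>c\<in>H. is_cycle V E c) \<and>
     (\<forall>c\<in>H. \<forall>d\<in>H. c \<noteq> d \<longrightarrow> set c \<inter> set d = {}) \<and>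
     \<not> has_cycle (V - cover H) E"

end

theory Submission
  imports Defs
begin

text \<open>
  The students left uncovered by a cycle packing span an acyclic envy graph. If there were
  \<open>\<epsilon> n\<close> of them, a topological order would split them into linearly large \<open>A\<close> and \<open>B\<close> such that no
  student of \<open>A\<close> envies one of \<open>B\<close>. Either linearly many students of \<open>A\<close> get one of their first
  \<open>k\<close> choices, or linearly many of them have no school matched to \<open>B\<close> among their first \<open>k\<close>
  choices. For large constant \<open>k\<close> the latter is excluded by a union bound over both sets.

  The former is excluded by a first moment bound over all perfect matchings, using only that the
  outcome of deferred acceptance is stable. Given the students' preferences, a matching is stable
  with probability \<open>\<Prod> 1 / (1 + d s)\<close>, where \<open>d s\<close> counts the students who prefer \<open>s\<close> to their match.
  Writing \<open>1 / (1 + d)\<close> as (at most) the average of \<open>y ^ d\<close> over a grid of \<open>y \<in> [0, 1]\<close> decouples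
  the students, and a Maclaurin-type inequality bounds each student's contribution by a geometric
  series in the mean of \<open>y\<close>. If \<open>s\<close> is the mean of \<open>1 - y\<close>, this gives \<open>(e s) ^ (- n)\<close> in total, which
  is dominated by \<open>(\<theta> exp (- \<theta> s)) ^ n\<close> for some \<open>\<theta>\<close> close to \<open>1 / s\<close>; its average over \<open>y\<close> is
  \<open>(1 - exp (- \<theta>)) ^ n\<close>, exponentially small for \<open>s\<close> bounded away from 0. For small \<open>s\<close>, the many
  students with a top-\<open>k\<close> choice yield the additional small factor.
\<close>

section \<open>Counting lists and permutations\<close>

text \<open>The \<open>takeWhile\<close> form recurses along the list, unlike the pair of indices in
  \<open>prefers\<close>; \<open>prefers_iff_above\<close> links the two.\<close>

definition above :: "'a list \<Rightarrow> 'a \<Rightarrow> 'a set" where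
  "above xs a = set (takeWhile (\<lambda>x. x \<noteq> a) xs)"

definition rank_of :: "'a list \<Rightarrow> 'a \<Rightarrow> nat" where
  "rank_of xs a = length (takeWhile (\<lambda>x. x \<noteq> a) xs)"

lemma above_Cons: "above (x # xs) a = (if x = a then {} else insert x (above xs a))"
  unfolding above_def by (cases "x = a") simp_all

lemma rank_Cons: "rank_of (x # xs) a = (if x = a then 0 else Suc (rank_of xs a))"
  by (simp add: rank_of_def)

lemma not_in_above_self: "a \<notin> above xs a"
  unfolding above_def by (auto dest: set_takeWhileD)

lemma above_subset: "above xs a \<subseteq> set xs"
  unfolding above_def by (auto dest: set_takeWhileD)

lemma rank_less_length: "a \<in> set xs \<Longrightarrow> rank_of xs a < length xs"
  by (induction xs) (auto simp: rank_Cons)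

lemma nth_rank: "a \<in> set xs \<Longrightarrow> xs ! rank_of xs a = a"
  by (induction xs) (auto simp: rank_Cons)

lemma rank_nth: "distinct xs \<Longrightarrow> i < length xs \<Longrightarrow> rank_of xs (xs ! i) = i"
  by (induction xs arbitrary: i) (auto simp: rank_Cons nth_Cons split: nat.splits)

lemma above_eq_take: "above xs a = set (take (rank_of xs a) xs)"
  unfolding above_def rank_of_def by (metis takeWhile_eq_take)

lemma prefers_iff_above:
  assumes "distinct xs" "b \<in> set xs"
  shows "prefers xs a b \<longleftrightarrow> a \<in> above xs b"
proof
  assume "prefers xs a b"
  then obtain i j where ij: "i < j" "j < length xs" "xs ! i = a" "xs ! j = b"
    unfolding prefers_def by blast
  then have "j = rank_of xs b" using assms rank_nth by metis
  then show "a \<in> above xs b" using ij unfolding above_eq_take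
    by (force simp: in_set_conv_nth)
next
  assume "a \<in> above xs b"
  then obtain i where "i < rank_of xs b" "i < length xs" "xs ! i = a"
    unfolding above_eq_take by (auto simp: in_set_conv_nth)
  then show "prefers xs a b"
    unfolding prefers_def using rank_less_length[OF assms(2)] nth_rank[OF assms(2)] by blast
qed

text \<open>Independence of the entries of a uniformly random list, in unnormalised form: weights
  and events that concern different students or different schools factorize.\<close>

lemma sum_lists_prod:
  fixes f :: "nat \<Rightarrow> 'a \<Rightarrow> 'b::comm_semiring_1"
  assumes "finite A"
  shows "(\<Sum>xs | set xs \<subseteq> A \<and> length xs = n. \<Prod>i<n. f i (xs ! i)) = (\<Prod>i<n. \<Sum>x\<in>A. f i x)"
proof (induction n arbitrary: f)
  case 0
  have "{xs :: 'a list. set xs \<subseteq> A \<and> length xs = 0} = {[]}" by auto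
  then show ?case by simp
next
  case (Suc n)
  let ?L = "\<lambda>n. {xs. set xs \<subseteq> A \<and> length xs = n}"
  have eq: "?L (Suc n) = (\<lambda>(x, xs). x # xs) ` (A \<times> ?L n)"
    by (auto simp: image_iff length_Suc_conv)
  have inj: "inj_on (\<lambda>(x, xs). x # xs) (A \<times> ?L n)" by (auto simp: inj_on_def)
  have "(\<Sum>xs\<in>?L (Suc n). \<Prod>i<Suc n. f i (xs ! i))
      = (\<Sum>(x, xs)\<in>A \<times> ?L n. f 0 x * (\<Prod>i<n. f (Suc i) (xs ! i)))"
    unfolding eq sum.reindex[OF inj] prod.lessThan_Suc_shift
    by (intro sum.cong) (auto simp del: prod.lessThan_Suc)
  also have "\<dots> = (\<Sum>x\<in>A. \<Sum>xs\<in>?L n. f 0 x * (\<Prod>i<n. f (Suc i) (xs ! i)))"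
    by (simp add: sum.cartesian_product)
  also have "\<dots> = (\<Sum>x\<in>A. f 0 x) * (\<Prod>i<n. \<Sum>x\<in>A. f (Suc i) x)"
    by (simp add: Suc.IH[of "\<lambda>i. f (Suc i)"] flip: sum_distrib_left sum_distrib_right)
  finally show ?case unfolding prod.lessThan_Suc_shift by simp
qed

lemma card_lists_pointwise:
  assumes "finite A"
  shows "card {xs. set xs \<subseteq> A \<and> length xs = n \<and> (\<forall>i<n. Q i (xs ! i))} = (\<Prod>i<n. card {x\<in>A. Q i x})"
proof -
  let ?L = "{xs. set xs \<subseteq> A \<and> length xs = n}"
  have fin: "finite ?L" by (rule finite_lists_length_eq[OF assms])
  have "card {xs. set xs \<subseteq> A \<and> length xs = n \<and> (\<forall>i<n. Q i (xs ! i))}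
      = card {xs\<in>?L. \<forall>i<n. Q i (xs ! i)}"
    by (rule arg_cong[where f = card]) auto
  also have "\<dots> = (\<Sum>xs\<in>?L. \<Prod>i<n. if Q i (xs ! i) then 1 else 0)"
  proof -
    have "(\<Prod>i<n. if Q i (xs ! i) then 1 else 0 :: nat) = (if \<forall>i<n. Q i (xs ! i) then 1 else 0)" for xs
      by (auto intro: prod.neutral)
    then show ?thesis using fin by (simp add: sum.If_cases Int_def)
  qed
  also have "\<dots> = (\<Prod>i<n. \<Sum>x\<in>A. if Q i x then 1 else 0)"
    by (rule sum_lists_prod[OF assms])
  also have "\<dots> = (\<Prod>i<n. card {x\<in>A. Q i x})"
    using assms by (simp add: sum.If_cases Int_def)
  finally show ?thesis .
qed

section \<open>Uniformly random permutations, analysed through their first entry\<close>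

lemma sum_permutations_Cons:
  fixes g :: "'a list \<Rightarrow> 'b::comm_monoid_add"
  assumes "finite A" "A \<noteq> {}"
  shows "(\<Sum>\<sigma>\<in>permutations_of_set A. g \<sigma>) = (\<Sum>x\<in>A. \<Sum>\<tau>\<in>permutations_of_set (A - {x}). g (x # \<tau>))"
proof -
  have "(\<Sum>\<sigma>\<in>permutations_of_set A. g \<sigma>)
      = (\<Sum>x\<in>A. \<Sum>\<sigma>\<in>(#) x ` permutations_of_set (A - {x}). g \<sigma>)"
    unfolding permutations_of_set_nonempty[OF assms(2)]
    using assms by (intro sum.UNION_disjoint) auto
  also have "\<dots> = (\<Sum>x\<in>A. \<Sum>\<tau>\<in>permutations_of_set (A - {x}). g (x # \<tau>))"
    by (rule sum.cong) (simp_all add: sum.reindex)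
  finally show ?thesis .
qed

lemma card_permutations_Cons:
  assumes "finite A" "A \<noteq> {}"
  shows "card {\<sigma>\<in>permutations_of_set A. Q \<sigma>}
       = (\<Sum>x\<in>A. card {\<tau>\<in>permutations_of_set (A - {x}). Q (x # \<tau>)})"
  using sum_permutations_Cons[OF assms, of "\<lambda>\<sigma>. if Q \<sigma> then 1 else (0::nat)"] assms
  by (simp add: sum.If_cases Int_def)

text \<open>By symmetry each of the \<open>1 + card B\<close> elements of \<open>insert a B\<close>
  is equally likely to come first among them. The induction conditions on the first entry:
  \<open>a\<close> succeeds, a member of \<open>B\<close> fails, and any other entry leaves the same
  problem on a smaller set.\<close>

lemma card_permutations_first_among:
  assumes "finite A" "a \<in> A" "B \<subseteq> A - {a}"
  shows "real (card {\<sigma>\<in>permutations_of_set A. above \<sigma> a \<inter> B = {}}) = fact (card A) / (1 + real (card B))"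
  using assms
proof (induction "card A" arbitrary: A)
  case 0
  then show ?case by simp
next
  case (Suc N)
  have finB: "finite B" using Suc.prems finite_subset by blast
  have cardB: "card B \<le> N"
    using Suc.prems Suc.hyps(2) card_mono[of "A - {a}" B] by simp
  let ?c = "\<lambda>x. real (card {\<tau>\<in>permutations_of_set (A - {x}). above (x # \<tau>) a \<inter> B = {}})"
  have ca: "?c a = fact N"
    using Suc.prems Suc.hyps(2)[symmetric] by (simp add: above_Cons)
  have cB: "?c x = 0" if "x \<in> B" for x
    using that Suc.prems by (auto simp: above_Cons)
  have cR: "?c x = fact N / (1 + real (card B))" if "x \<in> A - {a} - B" for x
  proof -
    have "?c x = real (card {\<tau>\<in>permutations_of_set (A - {x}). above \<tau> a \<inter> B = {}})"
      using that by (simp add: above_Cons)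
    also have "\<dots> = fact N / (1 + real (card B))"
    proof -
      have "N = card (A - {x})" "finite (A - {x})" "a \<in> A - {x}" "B \<subseteq> A - {x} - {a}"
        using that Suc.prems Suc.hyps(2)[symmetric] by auto
      from Suc.hyps(1)[OF this] show ?thesis using \<open>N = card (A - {x})\<close> by simp
    qed
    finally show ?thesis .
  qed
  have cardR: "card (A - {a} - B) = N - card B"
    using Suc.prems Suc.hyps(2) finB by (simp add: card_Diff_subset)
  have "real (card {\<sigma>\<in>permutations_of_set A. above \<sigma> a \<inter> B = {}}) = (\<Sum>x\<in>A. ?c x)"
    using Suc.prems by (subst card_permutations_Cons) auto
  also have "\<dots> = ?c a + (\<Sum>x\<in>B. ?c x) + (\<Sum>x\<in>A - {a} - B. ?c x)"
    using Suc.prems sum.remove[of A a ?c] sum.subset_diff[of B "A - {a}" ?c] by simp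
  also have "\<dots> = fact N + (N - card B) * (fact N / (1 + real (card B)))"
  proof -
    have "(\<Sum>x\<in>B. ?c x) = 0" using cB by (intro sum.neutral) blast
    moreover have "(\<Sum>x\<in>A - {a} - B. ?c x) = (\<Sum>x\<in>A - {a} - B. fact N / (1 + real (card B)))"
      by (rule sum.cong[OF refl cR])
    ultimately show ?thesis using ca cardR by simp
  qed
  also have "\<dots> = fact (card A) / (1 + real (card B))"
    using cardB Suc.hyps(2)[symmetric] by (simp add: of_nat_diff field_simps)
  finally show ?case .
qed

text \<open>Drawing without replacement avoids \<open>T\<close> at most as often as drawing with
  replacement, because every draw outside \<open>T\<close> raises the share of \<open>T\<close> in
  what is left.\<close>

lemma card_permutations_take_avoid:
  assumes "finite A" "T \<subseteq> A" "k \<le> card A"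
  shows "real (card {\<sigma>\<in>permutations_of_set A. set (take k \<sigma>) \<inter> T = {}})
       \<le> fact (card A) * (1 - real (card T) / real (card A)) ^ k"
  using assms
proof (induction k arbitrary: A)
  case 0
  then show ?case by simp
next
  case (Suc k)
  define N where "N = card A - 1"
  have N: "card A = Suc N" using Suc.prems by (simp add: N_def)
  have finT: "finite T" using Suc.prems finite_subset by blast
  have cT: "card T \<le> Suc N" using Suc.prems N card_mono by metis
  let ?c = "\<lambda>x. real (card {\<tau>\<in>permutations_of_set (A - {x}). set (take (Suc k) (x # \<tau>)) \<inter> T = {}})"
  let ?q = "1 - real (card T) / real (Suc N)"
  have c0: "?c x = 0" if "x \<in> T" for x using that by auto
  have c1: "?c x \<le> fact N * ?q ^ k" if x: "x \<in> A - T" for x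
  \<comment> \<open>With \<open>k = 0\<close> the remaining pool may be empty, whereas comparing
    \<open>card T / N\<close> with \<open>card T / Suc N\<close> needs \<open>N > 0\<close>.\<close>
  proof (cases "k = 0")
    case True
    have "?c x = fact N" using that True Suc.prems N by simp
    then show ?thesis using True by simp
  next
    case False
    then have Npos: "N > 0" using Suc.prems N by simp
    have cT': "card T \<le> N"
      using card_mono[of "A - {x}" T] Suc.prems x N by auto
    have "?c x = real (card {\<tau>\<in>permutations_of_set (A - {x}). set (take k \<tau>) \<inter> T = {}})"
      using x by simp
    also have "\<dots> \<le> fact N * (1 - real (card T) / real N) ^ k"
      using Suc.IH[of "A - {x}"] x Suc.prems N by auto
    also have "\<dots> \<le> fact N * ?q ^ k"
      using Npos cT' by (intro mult_left_mono power_mono) (auto simp: field_simps)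
    finally show ?thesis .
  qed
  have "real (card {\<sigma>\<in>permutations_of_set A. set (take (Suc k) \<sigma>) \<inter> T = {}}) = (\<Sum>x\<in>A. ?c x)"
    using Suc.prems N by (subst card_permutations_Cons) auto
  also have "\<dots> = (\<Sum>x\<in>A - T. ?c x)"
    using c0 Suc.prems by (intro sum.mono_neutral_right) auto
  also have "\<dots> \<le> (\<Sum>x\<in>A - T. fact N * ?q ^ k)"
    by (intro sum_mono c1) auto
  also have "\<dots> = (real (Suc N) - card T) * (fact N * ?q ^ k)"
    using Suc.prems finT N cT by (simp add: card_Diff_subset of_nat_diff)
  also have "real (Suc N) - card T = Suc N * ?q" by (simp add: field_simps)
  finally show ?case using N by (simp add: mult_ac)
qed

text \<open>Tangent-line inequality at the mean; equality at \<open>h = 0\<close>.\<close>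
lemma linear_times_power_le:
  fixes h :: real
  assumes "h \<le> 1" "r \<le> N"
  shows "(1 + N * h) * (1 - h) ^ r \<le> 1 + (real N - real r) * h"
  using assms(2)
proof (induction r)
  case 0
  then show ?case by simp
next
  case (Suc r)
  have "(1 + N * h) * (1 - h) ^ Suc r = ((1 + N * h) * (1 - h) ^ r) * (1 - h)" by simp
  also have "\<dots> \<le> (1 + (real N - real r) * h) * (1 - h)"
    using Suc assms(1) by (intro mult_right_mono) auto
  also have "\<dots> = 1 + (real N - real (Suc r)) * h - (real N - real r) * h\<^sup>2"
    by (simp add: algebra_simps power2_eq_square)
  also have "\<dots> \<le> 1 + (real N - real (Suc r)) * h"
    using Suc by simp
  finally show ?case .
qed

text \<open>One step of a Maclaurin-type inequality. Around the mean \<open>m\<close>, a value is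
  \<open>m * (1 + N * h)\<close> and the mean of the other values is \<open>m * (1 - h)\<close>. The
  tangent-line bound is linear in \<open>h\<close>, and the deviations \<open>h\<close> sum to
  0.\<close>

lemma sum_mult_power_rest_le:
  fixes y :: "'a \<Rightarrow> real"
  assumes "finite A" and N: "card A = Suc N" and "r \<le> N" and nn: "\<And>x. x \<in> A \<Longrightarrow> y x \<ge> 0"
  shows "(\<Sum>x\<in>A. y x * ((\<Sum>z\<in>A - {x}. y z) / N) ^ r) \<le> Suc N * ((\<Sum>x\<in>A. y x) / Suc N) ^ Suc r"
proof -
  define Y where "Y = (\<Sum>x\<in>A. y x)"
  define m where "m = Y / Suc N"
  have Y_m: "Y = Suc N * m" by (simp add: m_def)
  have rest: "(\<Sum>z\<in>A - {x}. y z) = Y - y x" if "x \<in> A" for x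
    using that assms(1) by (simp add: Y_def sum_diff1)
  have y_le: "y x \<le> Y" if "x \<in> A" for x
    unfolding Y_def using that assms(1) nn by (intro member_le_sum) auto
  have Y0: "Y \<ge> 0" unfolding Y_def using nn by (intro sum_nonneg) auto
  \<comment> \<open>The deviation \<open>h\<close> divides by \<open>m\<close> and by
    \<open>N\<close>; the degenerate cases are trivial, as \<open>N = 0\<close> forces
    \<open>r = 0\<close>.\<close>
  consider "Y = 0" | "N = 0" | "Y > 0" "N > 0" using Y0 by fastforce
  then show ?thesis
  proof cases
    case 1
    then have "y x = 0" if "x \<in> A" for x using y_le[OF that] nn[OF that] by simp
    then show ?thesis by simp
  next
    case 2
    then show ?thesis using assms by simp
  next
    case 3
    have mpos: "m > 0" using 3 by (simp add: m_def)
    define h where "h x = (y x / m - 1) / N" for x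
    have term_le: "y x * ((\<Sum>z\<in>A - {x}. y z) / N) ^ r \<le> m ^ Suc r * (1 + (real N - real r) * h x)"
      if x: "x \<in> A" for x
    proof -
      have a: "y x = m * (1 + N * h x)" using mpos 3 by (simp add: h_def)
      have b: "(Y - y x) / N = m * (1 - h x)"
        using mpos 3 by (simp add: h_def Y_m field_simps)
      have "h x \<le> 1" using y_le[OF x] mpos 3 by (simp add: h_def Y_m field_simps)
      then have "m ^ Suc r * ((1 + N * h x) * (1 - h x) ^ r) \<le> m ^ Suc r * (1 + (real N - real r) * h x)"
        using mpos assms(3) by (intro mult_left_mono linear_times_power_le) auto
      moreover have "y x * ((\<Sum>z\<in>A - {x}. y z) / N) ^ r = m ^ Suc r * ((1 + N * h x) * (1 - h x) ^ r)"
        unfolding rest[OF x] b by (subst a) (simp add: power_mult_distrib)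
      ultimately show ?thesis by simp
    qed
    have h0: "(\<Sum>x\<in>A. h x) = 0"
    proof -
      have "(\<Sum>x\<in>A. h x) = (Y / m - Suc N) / N"
        unfolding h_def using N by (simp add: sum_subtractf Y_def flip: sum_divide_distrib)
      then show ?thesis using mpos by (simp add: Y_m)
    qed
    have "(\<Sum>x\<in>A. y x * ((\<Sum>z\<in>A - {x}. y z) / N) ^ r)
        \<le> (\<Sum>x\<in>A. m ^ Suc r * (1 + (real N - real r) * h x))"
      by (intro sum_mono term_le)
    also have "\<dots> = m ^ Suc r * (Suc N + (real N - real r) * (\<Sum>x\<in>A. h x))"
      using N by (simp add: sum.distrib flip: sum_distrib_left)
    finally show ?thesis using h0 by (simp add: m_def Y_def mult.commute)
  qed
qed

text \<open>Given its rank \<open>r\<close>, the set above \<open>a\<close> is a uniformly random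
  \<open>r\<close>-subset of \<open>A - {a}\<close>, so this is Maclaurin's inequality between an
  elementary symmetric mean and a power of the mean. The induction strips the top entry and averages
  the bound for the rest over it.\<close>

lemma sum_permutations_rank_le:
  fixes y :: "'a \<Rightarrow> real"
  assumes "finite A" "a \<in> A" "r < card A" "\<And>x. x \<in> A \<Longrightarrow> y x \<ge> 0"
  shows "(\<Sum>\<sigma>\<in>permutations_of_set A. if rank_of \<sigma> a = r then \<Prod>x\<in>above \<sigma> a. y x else 0)
       \<le> fact (card A - 1) * ((\<Sum>x\<in>A - {a}. y x) / real (card A - 1)) ^ r"
  using assms
proof (induction r arbitrary: A)
  case 0
  have "(\<Sum>\<sigma>\<in>permutations_of_set A. if rank_of \<sigma> a = 0 then \<Prod>x\<in>above \<sigma> a. y x else 0)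
      = (\<Sum>x\<in>A. if x = a then fact (card A - 1) else 0)"
  proof -
    have "(\<Sum>\<tau>\<in>permutations_of_set (A - {x}). if rank_of (x # \<tau>) a = 0 then \<Prod>z\<in>above (x # \<tau>) a. y z else 0)
        = (if x = a then fact (card A - 1) else 0)" if "x \<in> A" for x
      using that 0 by (cases "x = a") (simp_all add: rank_Cons above_Cons)
    then show ?thesis using 0 by (subst sum_permutations_Cons) (auto simp del: sum.delta intro: sum.cong)
  qed
  also have "\<dots> = fact (card A - 1)" using 0 by (simp add: sum.delta)
  finally show ?case by simp
next
  case (Suc r)
  \<comment> \<open>The size of \<open>A - {a} - {x}\<close>, the pool that remains once the top
    entry \<open>x\<close> is fixed.\<close>
  define N where "N = card A - 2"
  have cA: "card A = Suc (Suc N)" using Suc.prems by (simp add: N_def)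
  have cAa: "card (A - {a}) = Suc N" using Suc.prems cA by simp
  have r_le: "r \<le> N" using Suc.prems cA by simp
  let ?S = "\<lambda>A r. \<Sum>\<sigma>\<in>permutations_of_set A. if rank_of \<sigma> a = r then \<Prod>x\<in>above \<sigma> a. y x else 0"
  have step: "(\<Sum>\<tau>\<in>permutations_of_set (A - {x}). if rank_of (x # \<tau>) a = Suc r then \<Prod>z\<in>above (x # \<tau>) a. y z else 0)
      = (if x = a then 0 else y x * ?S (A - {x}) r)" if "x \<in> A" for x
  proof -
    have "(\<Prod>z\<in>above (x # \<tau>) a. y z) = y x * (\<Prod>z\<in>above \<tau> a. y z)"
      if "\<tau> \<in> permutations_of_set (A - {x})" "x \<noteq> a" for \<tau>
    proof -
      have "x \<notin> above \<tau> a" using that above_subset[of \<tau> a] by (auto simp: permutations_of_set_def)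
      moreover have "finite (above \<tau> a)" by (simp add: above_def)
      ultimately show ?thesis using that by (simp add: above_Cons)
    qed
    then show ?thesis
      by (auto simp: rank_Cons sum_distrib_left intro!: sum.cong)
  qed
  have "?S A (Suc r) = (\<Sum>x\<in>A. if x = a then 0 else y x * ?S (A - {x}) r)"
    using Suc.prems cA step by (subst sum_permutations_Cons) (auto intro!: sum.cong)
  also have "\<dots> = (\<Sum>x\<in>A - {a}. y x * ?S (A - {x}) r)"
    using Suc.prems by (subst sum.remove[of _ a]) auto
  also have "\<dots> \<le> (\<Sum>x\<in>A - {a}. y x * (fact N * ((\<Sum>z\<in>A - {a} - {x}. y z) / N) ^ r))"
  proof (intro sum_mono mult_left_mono)
    fix x assume x: "x \<in> A - {a}"
    have "A - {x} - {a} = A - {a} - {x}" by auto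
    then show "?S (A - {x}) r \<le> fact N * ((\<Sum>z\<in>A - {a} - {x}. y z) / N) ^ r"
      using Suc.IH[of "A - {x}"] x Suc.prems cA r_le by auto
    show "y x \<ge> 0" using x Suc.prems by auto
  qed
  also have "\<dots> = fact N * (\<Sum>x\<in>A - {a}. y x * ((\<Sum>z\<in>A - {a} - {x}. y z) / N) ^ r)"
    by (simp add: sum_distrib_left mult_ac)
  also have "\<dots> \<le> fact N * (Suc N * ((\<Sum>x\<in>A - {a}. y x) / Suc N) ^ Suc r)"
    using Suc.prems cAa r_le by (intro mult_left_mono sum_mult_power_rest_le) auto
  also have "\<dots> = fact (card A - 1) * ((\<Sum>x\<in>A - {a}. y x) / real (card A - 1)) ^ Suc r"
    by (simp add: cA)
  finally show ?case .
qed

section \<open>Acyclic digraphs and stability of deferred acceptance\<close>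

text \<open>Iterating a choice of successors must revisit a vertex, by the pigeonhole principle; the
  orbit of a point of least period is then a cycle.\<close>

lemma exists_cycle:
  assumes "finite V" "V \<noteq> {}" "\<And>v. v \<in> V \<Longrightarrow> \<exists>w\<in>V. E v w"
  shows "has_cycle V E"
proof -
  obtain f where f: "\<And>v. v \<in> V \<Longrightarrow> f v \<in> V \<and> E v (f v)" using assms(3) by metis
  obtain x where x: "x \<in> V" using assms(2) by blast
  have it: "(f ^^ t) v \<in> V" if "v \<in> V" for t v
    using that f by (induction t) auto
  have "\<not> inj_on (\<lambda>t. (f ^^ t) x) {..card V}"
  proof
    assume "inj_on (\<lambda>t. (f ^^ t) x) {..card V}"
    then have "card {..card V} \<le> card V"
      using it[OF x] assms(1) by (intro card_inj_on_le) auto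
    then show False by simp
  qed
  then obtain a b where ab: "a < b" "(f ^^ a) x = (f ^^ b) x"
    unfolding inj_on_def by (metis linorder_neqE_nat)
  have "(f ^^ (b - a)) ((f ^^ a) x) = (f ^^ b) x"
    by (metis ab(1) comp_apply funpow_add le_add_diff_inverse2 less_imp_le)
  then have "\<exists>p>0. \<exists>y\<in>V. (f ^^ p) y = y" using ab it[OF x, of a]
    by (intro exI[of _ "b - a"]) auto
  \<comment> \<open>The least period is taken over all points of \<open>V\<close>: a repetition
    inside the orbit of \<open>y\<close> would give another point of that orbit a smaller period, so
    the entries of the cycle are distinct.\<close>
  define p where "p = (LEAST p. p > 0 \<and> (\<exists>y\<in>V. (f ^^ p) y = y))"
  have "p > 0 \<and> (\<exists>y\<in>V. (f ^^ p) y = y)"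
    unfolding p_def by (rule LeastI_ex) (use \<open>\<exists>p>0. \<exists>y\<in>V. (f ^^ p) y = y\<close> in blast)
  then obtain y where p: "p > 0" and y: "y \<in> V" "(f ^^ p) y = y" by blast
  have minimal: "p \<le> q" if "q > 0" "z \<in> V" "(f ^^ q) z = z" for q z
    unfolding p_def by (rule Least_le) (use that in blast)
  have distinct: "(f ^^ i) y \<noteq> (f ^^ j) y" if "i < j" "j < p" for i j
  proof
    assume eq: "(f ^^ i) y = (f ^^ j) y"
    have "(f ^^ (j - i)) ((f ^^ i) y) = (f ^^ j) y"
      by (metis that(1) comp_apply funpow_add le_add_diff_inverse2 less_imp_le)
    then have "p \<le> j - i" using minimal[of "j - i" "(f ^^ i) y"] eq that it[OF y(1)] by simp
    then show False using that by simp
  qed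
  define c where "c = map (\<lambda>t. (f ^^ t) y) [0..<p]"
  have "E (c ! t) (c ! ((t + 1) mod length c))" if "t < length c" for t
  proof -
    have t: "t < p" using that by (simp add: c_def)
    have "c ! ((t + 1) mod length c) = f ((f ^^ t) y)"
    proof (cases "t + 1 = p")
      case True
      then have "f ((f ^^ t) y) = (f ^^ p) y" by (metis Suc_eq_plus1 funpow.simps(2) comp_apply)
      then show ?thesis using True p y(2) by (simp add: c_def)
    next
      case False
      then show ?thesis using t by (simp add: c_def)
    qed
    then show ?thesis using f[OF it[OF y(1)]] t by (simp add: c_def)
  qed
  moreover have "distinct c"
    unfolding distinct_conv_nth using distinct by (auto simp: c_def) (metis linorder_neqE_nat)
  moreover have "c \<noteq> []" "set c \<subseteq> V" using p it[OF y(1)] by (auto simp: c_def)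
  ultimately show ?thesis unfolding has_cycle_def is_cycle_def by blast
qed

lemma has_cycle_mono: "has_cycle V E \<Longrightarrow> V \<subseteq> W \<Longrightarrow> has_cycle W E"
  unfolding has_cycle_def is_cycle_def by blast

text \<open>\<open>A\<close> is an initial piece of a topological order that starts with the sinks.
  The acyclic remainder always has a vertex without edges into the remainder, and moving that vertex
  to \<open>A\<close> creates no edge leaving \<open>A\<close>.\<close>

lemma acyclic_split:
  assumes "finite W" "\<not> has_cycle W E" "m \<le> card W"
  shows "\<exists>A\<subseteq>W. card A = m \<and> (\<forall>a\<in>A. \<forall>b\<in>W - A. \<not> E a b)"
  using assms(3)
proof (induction m)
  case 0
  then show ?case by (intro exI[of _ "{}"]) auto
next
  case (Suc m)
  then obtain A where A: "A \<subseteq> W" "card A = m" "\<forall>a\<in>A. \<forall>b\<in>W - A. \<not> E a b" by auto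
  have "W - A \<noteq> {}" using A Suc.prems assms(1) by auto
  moreover have "\<not> has_cycle (W - A) E" using assms(2) has_cycle_mono by blast
  ultimately obtain v where v: "v \<in> W - A" "\<forall>w\<in>W - A. \<not> E v w"
    using exists_cycle[of "W - A" E] assms(1) by blast
  have "card (insert v A) = Suc m"
    using v A assms(1) finite_subset[OF A(1)] by simp
  then show ?case using A v by (intro exI[of _ "insert v A"]) auto
qed

section \<open>Deferred acceptance terminates in a perfect stable matching\<close>

lemma problems_nth:
  assumes "P \<in> problems n" "i < n"
  shows "fst P ! i \<in> permutations_of_set {0..<n}" "snd P ! i \<in> permutations_of_set {0..<n}"
proof -
  have "length (fst P) = n" "length (snd P) = n"
    "set (fst P) \<subseteq> permutations_of_set {0..<n}" "set (snd P) \<subseteq> permutations_of_set {0..<n}"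
    using assms(1) by (auto simp: problems_def)
  then show "fst P ! i \<in> permutations_of_set {0..<n}" "snd P ! i \<in> permutations_of_set {0..<n}"
    using assms(2) nth_mem[of i "fst P"] nth_mem[of i "snd P"] by auto
qed

lemma rank_of_inject: "a \<in> set xs \<Longrightarrow> b \<in> set xs \<Longrightarrow> rank_of xs a = rank_of xs b \<Longrightarrow> a = b"
  by (drule arg_cong[where f = "(!) xs"]) (simp add: nth_rank)

lemma in_above_iff_rank:
  assumes "distinct xs" "a \<in> set xs"
  shows "a \<in> above xs b \<longleftrightarrow> rank_of xs a < rank_of xs b"
proof
  assume "a \<in> above xs b"
  then obtain i where "i < rank_of xs b" "i < length xs" "xs ! i = a"
    unfolding above_eq_take by (auto simp: in_set_conv_nth)
  then show "rank_of xs a < rank_of xs b" using rank_nth[OF assms(1)] by auto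
next
  assume "rank_of xs a < rank_of xs b"
  then show "a \<in> above xs b"
    unfolding above_eq_take
    using nth_rank[OF assms(2)] rank_less_length[OF assms(2)]
    by (metis in_set_conv_nth length_take min_less_iff_conj nth_take)
qed

text \<open>A school that has rejected somebody keeps holding a student of higher priority.\<close>
definition da_inv :: "nat \<Rightarrow> problem \<Rightarrow> (nat \<Rightarrow> nat) \<Rightarrow> bool" where
  "da_inv n P k \<longleftrightarrow> (\<forall>i<n. k i < n) \<and>
     (\<forall>i<n. \<forall>t<k i. \<exists>j<n. da_applies P k j = fst P ! i ! t \<and>
        rank_of (snd P ! (fst P ! i ! t)) j < rank_of (snd P ! (fst P ! i ! t)) i)"

context
  fixes n :: nat and P :: problem
  assumes P: "P \<in> problems n"
begin

lemma sp_perm: "i < n \<Longrightarrow> set (fst P ! i) = {0..<n} \<and> distinct (fst P ! i) \<and> length (fst P ! i) = n"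
  and sc_perm: "i < n \<Longrightarrow> set (snd P ! i) = {0..<n} \<and> distinct (snd P ! i) \<and> length (snd P ! i) = n"
  using problems_nth[OF P, of i] length_finite_permutations_of_set[of _ "{0..<n}"]
  by (auto simp: permutations_of_set_def)

lemma da_applies_less: "da_inv n P k \<Longrightarrow> i < n \<Longrightarrow> da_applies P k i < n"
  unfolding da_inv_def da_applies_def using sp_perm[of i] nth_mem[of "k i" "fst P ! i"] by auto

lemma prefers_sc_iff:
  assumes "s < n" "i < n" "j < n"
  shows "prefers (snd P ! s) j i \<longleftrightarrow> rank_of (snd P ! s) j < rank_of (snd P ! s) i"
  using assms sc_perm[of s] by (simp add: prefers_iff_above in_above_iff_rank)

text \<open>What a school holds never gets worse: its best current applicant is not rejected and
  hence applies there again in the next round.\<close>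

lemma best_applicant:
  assumes inv: "da_inv n P k" and i: "i < n"
  obtains j where "j < n" "da_applies P (da_step n P k) j = da_applies P k i"
    "rank_of (snd P ! da_applies P k i) j \<le> rank_of (snd P ! da_applies P k i) i"
proof -
  define s where "s = da_applies P k i"
  have s: "s < n" using da_applies_less[OF inv i] by (simp add: s_def)
  obtain j where j: "j < n \<and> da_applies P k j = s"
    and least: "\<And>j'. j' < n \<and> da_applies P k j' = s \<Longrightarrow> rank_of (snd P ! s) j \<le> rank_of (snd P ! s) j'"
    using ex_has_least_nat[of "\<lambda>j. j < n \<and> da_applies P k j = s" i "rank_of (snd P ! s)"] i
    by (auto simp: s_def)
  have "\<not> da_rejected n P k j"
    unfolding da_rejected_def using j least prefers_sc_iff[OF s]
    by (metis linorder_not_less)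
  then have "da_applies P (da_step n P k) j = s" using j by (simp add: da_step_def da_applies_def)
  then show ?thesis using that[of j] j least[of i] i by (simp add: s_def)
qed

lemma da_inv_step:
  assumes inv: "da_inv n P k"
  shows "da_inv n P (da_step n P k)"
proof -
  let ?k' = "da_step n P k"
  have holds: "\<exists>j<n. da_applies P ?k' j = fst P ! i ! t \<and>
        rank_of (snd P ! (fst P ! i ! t)) j < rank_of (snd P ! (fst P ! i ! t)) i"
    if i: "i < n" and t: "t < ?k' i" for i t
  proof -
    have "\<exists>j<n. da_applies P k j = fst P ! i ! t \<and>
        rank_of (snd P ! (fst P ! i ! t)) j < rank_of (snd P ! (fst P ! i ! t)) i"
    proof (cases "t < k i")
      case True
      then show ?thesis using inv i unfolding da_inv_def by blast
    next
      case False
      then have rej: "da_rejected n P k i" and t: "t = k i"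
        using t i by (auto simp: da_step_def split: if_splits)
      then show ?thesis
        using prefers_sc_iff[OF da_applies_less[OF inv i] i]
        unfolding da_rejected_def by (auto simp: da_applies_def)
    qed
    then obtain j where j: "j < n" "da_applies P k j = fst P ! i ! t"
      "rank_of (snd P ! (fst P ! i ! t)) j < rank_of (snd P ! (fst P ! i ! t)) i" by blast
    \<comment> \<open>The witness \<open>j\<close> may itself be rejected in this round; the best
      applicant at the same school then takes its place.\<close>
    show ?thesis using best_applicant[OF inv j(1)] j by (metis le_less_trans)
  qed
  \<comment> \<open>No student exhausts her list: otherwise every school would have rejected
    \<open>i\<close> and would hold somebody else, so \<open>n\<close> schools would hold distinct
    students among the other \<open>n - 1\<close>.\<close>
  have "?k' i < n" if i: "i < n" for i
  proof (rule ccontr)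
    assume ge: "\<not> ?k' i < n"
    have "\<exists>j. j < n \<and> j \<noteq> i \<and> da_applies P ?k' j = s" if s: "s < n" for s
    proof -
      obtain t where "t < n" "fst P ! i ! t = s"
        using sp_perm[OF i] s by (metis atLeast0LessThan in_set_conv_nth lessThan_iff)
      then show ?thesis using holds[OF i, of t] ge by (metis less_irrefl less_le_trans not_less)
    qed
    then obtain g where g: "\<And>s. s < n \<Longrightarrow> g s < n \<and> g s \<noteq> i \<and> da_applies P ?k' (g s) = s" by metis
    have "inj_on g {0..<n}" by (rule inj_onI) (metis g atLeastLessThan_iff)
    then have "card {0..<n} \<le> card ({0..<n} - {i})"
      by (rule card_inj_on_le) (use g in fastforce)+
    then show False using i by simp
  qed
  then show ?thesis using holds unfolding da_inv_def by blast
qed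

definition da_state :: "nat \<Rightarrow> nat \<Rightarrow> nat" where
  "da_state m = (da_step n P ^^ m) (\<lambda>_. 0)"

lemma da_inv_state: "da_inv n P (da_state m)"
proof (induction m)
  case 0
  have "n > 0" if "i < n" for i using that by simp
  then show ?case by (simp add: da_inv_def da_state_def)
next
  case (Suc m)
  then show ?case using da_inv_step by (simp add: da_state_def)
qed

text \<open>The number of rejections so far is a potential. It grows in every round that is not yet
  stationary, and \<open>da_inv\<close> keeps it below \<open>n * n\<close> when
  \<open>n > 0\<close>.\<close>

lemma da_fixpoint: "da_step n P (da_state (n * n)) = da_state (n * n)"
proof -
  have progress: "da_step n P (da_state m) = da_state m \<or> m \<le> (\<Sum>i<n. da_state m i)" for m
  proof (induction m)
    case 0
    then show ?case by simp
  next
    case (Suc m)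
    have S: "da_state (Suc m) = da_step n P (da_state m)" by (simp add: da_state_def)
    show ?case
    proof (cases "da_step n P (da_state m) = da_state m")
      case True
      then show ?thesis using S by simp
    next
      case False
      then obtain i where i: "i < n" "da_rejected n P (da_state m) i"
        unfolding da_step_def by (auto simp: fun_eq_iff split: if_splits)
      have "(\<Sum>i<n. da_state m i) < (\<Sum>i<n. da_state (Suc m) i)"
        unfolding S by (rule sum_strict_mono_ex1) (use i in \<open>auto simp: da_step_def\<close>)
      then show ?thesis using Suc False by simp
    qed
  qed
  show ?thesis
  proof (cases "n = 0")
    case True
    then show ?thesis by (simp add: da_step_def)
  next
    case False
    have "(\<Sum>i<n. da_state (n * n) i) < (\<Sum>i<n. n)"
      using da_inv_state[of "n * n"] False by (intro sum_strict_mono) (auto simp: da_inv_def)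
    then show ?thesis using progress[of "n * n"] by simp
  qed
qed

text \<open>At the fixpoint nobody is rejected, so no school has two applicants, and an injective
  self-map of a finite set is bijective. For stability, a school that \<open>i\<close> prefers to
  her outcome has rejected her; by the invariant it holds a student of higher priority, who is
  \<open>j\<close> by injectivity.\<close>

lemma DA_bij: "bij_betw (DA n P) {0..<n} {0..<n}"
  and DA_stable: "i < n \<Longrightarrow> j < n \<Longrightarrow> DA n P j \<in> above (fst P ! i) (DA n P i)
    \<Longrightarrow> i \<notin> above (snd P ! DA n P j) j"
proof -
  let ?k = "da_state (n * n)"
  have DA: "DA n P = da_applies P ?k" by (simp add: DA_def da_state_def)
  note inv = da_inv_state[of "n * n"]
  have lt: "DA n P i < n" if "i < n" for i using da_applies_less[OF inv that] by (simp add: DA)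
  have not_rej: "\<not> da_rejected n P ?k i" if "i < n" for i
    using fun_cong[OF da_fixpoint, of i] that by (auto simp: da_step_def)
  have inj: "inj_on (DA n P) {0..<n}"
  proof (rule inj_onI, rule ccontr)
    fix i j assume ij: "i \<in> {0..<n}" "j \<in> {0..<n}" "DA n P i = DA n P j" "i \<noteq> j"
    let ?s = "DA n P i"
    have "rank_of (snd P ! ?s) i \<noteq> rank_of (snd P ! ?s) j"
      using rank_of_inject[of i "snd P ! ?s" j] sc_perm[of ?s] ij lt[of i] by auto
    moreover have "\<not> rank_of (snd P ! ?s) i < rank_of (snd P ! ?s) j"
      using not_rej[of j] prefers_sc_iff[of ?s j i] ij lt[of i] unfolding da_rejected_def DA by auto
    moreover have "\<not> rank_of (snd P ! ?s) j < rank_of (snd P ! ?s) i"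
      using not_rej[of i] prefers_sc_iff[of ?s i j] ij lt[of i] unfolding da_rejected_def DA by auto
    ultimately show False by simp
  qed
  show bij: "bij_betw (DA n P) {0..<n} {0..<n}"
    unfolding bij_betw_def
    using inj lt endo_inj_surj[of "{0..<n}" "DA n P"] by (simp add: image_subset_iff)
  show "i \<notin> above (snd P ! DA n P j) j"
    if ij: "i < n" "j < n" "DA n P j \<in> above (fst P ! i) (DA n P i)"
  proof -
    have ki: "?k i < n" using inv ij by (simp add: da_inv_def)
    \<comment> \<open>The position of the final school equals the number of rejections, so every
      strictly preferred school has rejected \<open>i\<close>.\<close>
    have "rank_of (fst P ! i) (DA n P i) = ?k i"
      unfolding DA da_applies_def using sp_perm[OF ij(1)] ki by (intro rank_nth) auto
    then obtain t where t: "t < ?k i" "fst P ! i ! t = DA n P j"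
      using ij(3) unfolding above_eq_take by (auto simp: in_set_conv_nth)
    then obtain j' where j': "j' < n" "DA n P j' = DA n P j"
      "rank_of (snd P ! DA n P j) j' < rank_of (snd P ! DA n P j) i"
      using inv ij(1) unfolding da_inv_def DA by metis
    then have "j' = j" using inj ij by (auto simp: inj_on_def)
    then show ?thesis
      using j' sc_perm[OF lt[OF ij(2)]] ij by (simp add: in_above_iff_rank)
  qed
qed

end

section \<open>Union bound over avoided schools\<close>

abbreviation profiles :: "nat \<Rightarrow> nat list list set" where
  "profiles n \<equiv> {xs. set xs \<subseteq> permutations_of_set {0..<n} \<and> length xs = n}"

lemma finite_profiles: "finite (profiles n)"
  by (rule finite_lists_length_eq) simp

lemma card_profiles: "card (profiles n) = fact n ^ n"
  by (simp add: card_lists_length_eq)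

lemma problems_eq: "problems n = profiles n \<times> profiles n"
  unfolding problems_def by auto

lemma card_problems: "real (card (problems n)) = (fact n ^ n) * (fact n ^ n)"
  by (simp add: problems_eq card_cartesian_product card_profiles)

lemma profiles_nth: "sp \<in> profiles n \<Longrightarrow> i < n \<Longrightarrow> sp ! i \<in> permutations_of_set {0..<n}"
  using nth_mem by blast

text \<open>Union bound over at most \<open>4 ^ n\<close> pairs \<open>(A, T)\<close>. For a fixed
  pair, at least \<open>\<delta> * n\<close> independent students avoid \<open>T\<close> in their
  first \<open>k\<close> choices, each with probability at most \<open>(1 - \<delta>) ^ k\<close>.
  For large \<open>k\<close> the base of the resulting power is below 1.\<close>

lemma card_avoiding_problems_le:
  fixes \<delta> :: real
  assumes "0 < \<delta>" "\<delta> < 1" "k \<le> n" "0 < n"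
  shows "real (card {P\<in>problems n. \<exists>A\<subseteq>{0..<n}. \<exists>T\<subseteq>{0..<n}. \<delta> * n \<le> card A \<and> \<delta> * n \<le> card T \<and>
            (\<forall>i\<in>A. set (take k (fst P ! i)) \<inter> T = {})})
       \<le> card (problems n) * (4 * ((1 - \<delta>) ^ k) powr \<delta>) ^ n"
    (is "real (card ?S) \<le> _")
proof -
  let ?I = "{A. A \<subseteq> {0..<n} \<and> \<delta> * n \<le> card A}"
  let ?q = "(1 - \<delta>) ^ k"
  define F where "F A T = {sp. set sp \<subseteq> permutations_of_set {0..<n} \<and> length sp = n \<and>
      (\<forall>i<n. i \<in> A \<longrightarrow> set (take k (sp ! i)) \<inter> T = {})}" for A T
  have fin: "finite (F A T)" for A T
    by (rule finite_subset[OF _ finite_profiles[of n]]) (auto simp: F_def)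
  have finI: "finite ?I" by simp
  have cI: "card ?I \<le> 2 ^ n"
    using card_mono[of "Pow {0..<n}" ?I] by (auto simp: card_Pow)
  have F_le: "real (card (F A T)) \<le> fact n ^ n * (?q powr \<delta>) ^ n"
    if A: "A \<in> ?I" and T: "T \<in> ?I" for A T
  proof -
    have finA: "finite A" using A finite_subset by auto
    have each: "real (card {\<sigma>\<in>permutations_of_set {0..<n}. i \<in> A \<longrightarrow> set (take k \<sigma>) \<inter> T = {}})
        \<le> fact n * (if i \<in> A then ?q else 1)" for i
    proof (cases "i \<in> A")
      case True
      have "real (card {\<sigma>\<in>permutations_of_set {0..<n}. set (take k \<sigma>) \<inter> T = {}})
          \<le> fact n * (1 - real (card T) / real n) ^ k"
        using card_permutations_take_avoid[of "{0..<n}" T k] T assms by simp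
      also have "\<dots> \<le> fact n * ?q"
      proof (intro mult_left_mono power_mono)
        show "1 - real (card T) / real n \<le> 1 - \<delta>" using T assms by (simp add: field_simps)
        have "card T \<le> n" using T card_mono[of "{0..<n}" T] by simp
        then show "0 \<le> 1 - real (card T) / real n" using assms by (simp add: field_simps)
      qed simp
      finally show ?thesis using True by simp
    qed simp
    have "real (card (F A T))
        = (\<Prod>i<n. real (card {\<sigma>\<in>permutations_of_set {0..<n}. i \<in> A \<longrightarrow> set (take k \<sigma>) \<inter> T = {}}))"
      unfolding F_def by (subst card_lists_pointwise) simp_all
    also have "\<dots> \<le> (\<Prod>i<n. fact n * (if i \<in> A then ?q else 1))"
      by (intro prod_mono conjI each) simp
    also have "\<dots> = fact n ^ n * ?q ^ card A"
    proof -
      have "{..<n} \<inter> A = A" using A by auto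
      then show ?thesis by (simp add: prod.distrib prod.If_cases)
    qed
    also have "?q ^ card A = ?q powr real (card A)"
      using assms by (simp add: powr_realpow)
    also have "\<dots> \<le> ?q powr (\<delta> * n)"
      using A assms by (intro powr_mono') (auto simp: power_le_one)
    also have "\<dots> = (?q powr \<delta>) ^ n"
      using assms by (simp add: powr_realpow[symmetric] powr_powr mult.assoc)
    finally show ?thesis by simp
  qed
  have "?S \<subseteq> (\<Union>A\<in>?I. \<Union>T\<in>?I. F A T \<times> profiles n)"
  proof
    fix P assume "P \<in> ?S"
    then obtain A T where P: "P \<in> problems n" and AT: "A \<in> ?I" "T \<in> ?I"
      and av: "\<forall>i\<in>A. set (take k (fst P ! i)) \<inter> T = {}" by blast
    have "P \<in> F A T \<times> profiles n" using P av unfolding problems_eq F_def by fastforce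
    then show "P \<in> (\<Union>A\<in>?I. \<Union>T\<in>?I. F A T \<times> profiles n)" using AT by blast
  qed
  then have "card ?S \<le> card (\<Union>A\<in>?I. \<Union>T\<in>?I. F A T \<times> profiles n)"
    by (intro card_mono finite_UN_I finI finite_cartesian_product fin finite_profiles)
  also have "\<dots> \<le> (\<Sum>A\<in>?I. card (\<Union>T\<in>?I. F A T \<times> profiles n))"
    by (rule card_UN_le[OF finI])
  also have "\<dots> \<le> (\<Sum>A\<in>?I. \<Sum>T\<in>?I. card (F A T \<times> profiles n))"
    by (intro sum_mono card_UN_le[OF finI])
  finally have "real (card ?S) \<le> real (\<Sum>A\<in>?I. \<Sum>T\<in>?I. card (F A T \<times> profiles n))"
    by (rule of_nat_mono)
  also have "\<dots> = (\<Sum>A\<in>?I. \<Sum>T\<in>?I. real (card (F A T)) * fact n ^ n)"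
    by (simp add: card_cartesian_product card_profiles)
  also have "\<dots> \<le> (\<Sum>A\<in>?I. \<Sum>T\<in>?I. (fact n ^ n * (?q powr \<delta>) ^ n) * fact n ^ n)"
    by (intro sum_mono mult_right_mono F_le) auto
  also have "\<dots> = real (card ?I * card ?I) * ((fact n ^ n * (?q powr \<delta>) ^ n) * fact n ^ n)"
    by (simp only: sum_constant of_nat_mult mult.assoc)
  also have "\<dots> \<le> real (2 ^ n * 2 ^ n) * ((fact n ^ n * (?q powr \<delta>) ^ n) * fact n ^ n)"
    using mult_le_mono[OF cI cI] by (intro mult_right_mono of_nat_mono) auto
  also have "\<dots> = card (problems n) * (4 * ?q powr \<delta>) ^ n"
    by (simp add: card_problems power_mult_distrib flip: power_mult_distrib[of "2::real" 2])
  finally show ?thesis .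
qed

section \<open>First moment bound over stable matchings\<close>

text \<open>\<open>1 / (1 + d)\<close> is the integral of \<open>y ^ d\<close> over
  \<open>[0, 1]\<close>, and the right side is an upper Riemann sum. Each cell is estimated by
  Bernoulli's inequality, and the differences of powers with exponent \<open>Suc d\<close>
  telescope.\<close>

lemma inverse_Suc_le_Riemann_sum:
  assumes "M > 0"
  shows "1 / (1 + real d) \<le> (\<Sum>u<M. (1 - real u / real M) ^ d) / real M"
proof -
  let ?f = "\<lambda>u. (1 - real u / real M) ^ Suc d"
  have step: "?f u - ?f (Suc u) \<le> (1 + real d) / M * (1 - real u / real M) ^ d" if "u < M" for u
  proof -
    let ?a = "1 - real u / real M"
    have a: "?a \<ge> 1 / M" "?a > 0" using that assms by (auto simp: field_simps)
    \<comment> \<open>Chosen so that \<open>?a * (1 + ?x)\<close> is the next grid point. In the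
      last cell \<open>?x = -1\<close>, which Bernoulli's inequality still admits.\<close>
    let ?x = "- (1 / M / ?a)"
    have cancel: "b * - (1 / M / b) = - (1 / M)" if "b \<noteq> 0" for b :: real using that by simp
    have ax: "?a * ?x = - (1 / M)" by (rule cancel) (use a(2) in linarith)
    have "1 / M / ?a \<le> 1" using a by (subst divide_le_eq_1) auto
    then have "1 + real (Suc d) * ?x \<le> (1 + ?x) ^ Suc d"
      by (intro Bernoulli_inequality) linarith
    then have "?a ^ Suc d * (1 + real (Suc d) * ?x) \<le> ?a ^ Suc d * (1 + ?x) ^ Suc d"
      using a by (intro mult_left_mono) auto
    also have "\<dots> = (?a * (1 + ?x)) ^ Suc d" by (rule power_mult_distrib[symmetric])
    also have "?a * (1 + ?x) = 1 - real (Suc u) / real M"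
      unfolding distrib_left ax by (simp add: add_divide_distrib)
    finally have *: "?a ^ Suc d * (1 + real (Suc d) * ?x) \<le> ?f (Suc u)" .
    have "?a * (1 + real (Suc d) * ?x) = ?a - real (Suc d) / M"
    proof -
      have "?a * (real (Suc d) * ?x) = real (Suc d) * (?a * ?x)" by simp
      also have "\<dots> = - (real (Suc d) / M)" unfolding ax by simp
      finally show ?thesis unfolding distrib_left by simp
    qed
    then have "?a ^ Suc d * (1 + real (Suc d) * ?x) = ?a ^ d * (?a - real (Suc d) / M)"
      by (metis mult.assoc power_Suc2)
    also have "\<dots> = ?f u - (1 + real d) / M * ?a ^ d"
      by (simp add: right_diff_distrib algebra_simps)
    finally show ?thesis using * by linarith
  qed
  have "1 = (\<Sum>u<M. ?f u - ?f (Suc u))"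
    using sum_lessThan_telescope'[of ?f M] assms by simp
  also have "\<dots> \<le> (\<Sum>u<M. (1 + real d) / M * (1 - real u / real M) ^ d)"
    by (intro sum_mono step) auto
  also have "\<dots> = (1 + real d) * ((\<Sum>u<M. (1 - real u / real M) ^ d) / M)"
    by (simp add: sum_divide_distrib sum_distrib_left)
  finally show ?thesis by (simp add: divide_le_eq mult.commute)
qed

lemma sum_permutations_weighted_le:
  fixes y :: "'a \<Rightarrow> real" and w :: "nat \<Rightarrow> real"
  assumes "finite A" "a \<in> A" "\<And>x. x \<in> A \<Longrightarrow> y x \<ge> 0" "\<And>r. w r \<ge> 0"
  shows "(\<Sum>\<sigma>\<in>permutations_of_set A. w (rank_of \<sigma> a) * (\<Prod>x\<in>above \<sigma> a. y x))
       \<le> fact (card A - 1) * (\<Sum>r<card A. w r * ((\<Sum>x\<in>A - {a}. y x) / real (card A - 1)) ^ r)"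
proof -
  let ?f = "\<lambda>\<sigma>. \<Prod>x\<in>above \<sigma> a. y x"
  have "w (rank_of \<sigma> a) * ?f \<sigma> = (\<Sum>r<card A. w r * (if rank_of \<sigma> a = r then ?f \<sigma> else 0))"
    if "\<sigma> \<in> permutations_of_set A" for \<sigma>
  proof -
    have "rank_of \<sigma> a < card A"
      using that assms rank_less_length[of a \<sigma>] length_finite_permutations_of_set[OF that]
      by (auto simp: permutations_of_set_def)
    moreover have "(\<Sum>r<card A. w r * (if rank_of \<sigma> a = r then ?f \<sigma> else 0))
        = (\<Sum>r<card A. if rank_of \<sigma> a = r then w r * ?f \<sigma> else 0)"
      by (intro sum.cong) auto
    ultimately show ?thesis by simp
  qed
  then have "(\<Sum>\<sigma>\<in>permutations_of_set A. w (rank_of \<sigma> a) * ?f \<sigma>)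
      = (\<Sum>\<sigma>\<in>permutations_of_set A. \<Sum>r<card A. w r * (if rank_of \<sigma> a = r then ?f \<sigma> else 0))"
    by (rule sum.cong[OF refl])
  also have "\<dots> = (\<Sum>r<card A. w r * (\<Sum>\<sigma>\<in>permutations_of_set A. if rank_of \<sigma> a = r then ?f \<sigma> else 0))"
    by (subst sum.swap) (simp only: sum_distrib_left)
  also have "\<dots> \<le> (\<Sum>r<card A. w r * (fact (card A - 1) * ((\<Sum>x\<in>A - {a}. y x) / real (card A - 1)) ^ r))"
    using assms by (intro sum_mono mult_left_mono sum_permutations_rank_le) auto
  finally show ?thesis by (simp add: sum_distrib_left mult.left_commute)
qed

definition many_low :: "nat \<Rightarrow> nat \<Rightarrow> real \<Rightarrow> nat list list \<Rightarrow> (nat \<Rightarrow> nat) \<Rightarrow> bool" where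
  "many_low n k \<delta> sp \<pi> \<longleftrightarrow> \<delta> * n \<le> card {i. i < n \<and> rank_of (sp ! i) (\<pi> i) < k}"

text \<open>Exponential Markov inequality: every student with a low rank gets the weight \<open>\<kappa>\<close>.\<close>
lemma sum_profiles_many_low_le:
  fixes y :: "nat \<Rightarrow> real"
  assumes \<pi>: "\<pi> permutes {0..<n}" and y: "\<And>s. s < n \<Longrightarrow> y s \<ge> 0" and \<kappa>: "\<kappa> \<ge> 1"
  defines "a \<equiv> \<lambda>i. (\<Sum>s\<in>{0..<n} - {\<pi> i}. y s) / real (n - 1)"
  shows "(\<Sum>sp | sp \<in> profiles n \<and> many_low n k \<delta> sp \<pi>. \<Prod>i<n. \<Prod>s\<in>above (sp ! i) (\<pi> i). y s)
     \<le> \<kappa> powr (- \<delta> * n) * fact (n - 1) ^ n * (\<Prod>i<n. \<Sum>r<n. (if r < k then \<kappa> else 1) * a i ^ r)"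
proof -
  define w where "w r = (if r < k then \<kappa> else 1)" for r
  let ?g = "\<lambda>sp. \<Prod>i<n. \<Prod>s\<in>above (sp ! i) (\<pi> i). y s"
  let ?h = "\<lambda>i \<sigma>. w (rank_of \<sigma> (\<pi> i)) * (\<Prod>s\<in>above \<sigma> (\<pi> i). y s)"
  have fin: "finite (profiles n)" by (rule finite_profiles)
  have g_nonneg: "(\<Prod>s\<in>above (sp ! i) (\<pi> i). y s) \<ge> 0" if "sp \<in> profiles n" "i < n" for sp i
  proof -
    have "set (sp ! i) = {0..<n}" using profiles_nth[OF that] by (simp add: permutations_of_set_def)
    then show ?thesis using above_subset[of "sp ! i" "\<pi> i"] y by (intro prod_nonneg) auto
  qed
  have point: "?g sp \<le> \<kappa> powr (- \<delta> * n) * (\<Prod>i<n. ?h i (sp ! i))"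
    if "sp \<in> profiles n" "many_low n k \<delta> sp \<pi>" for sp
  proof -
    have "(\<Prod>i<n. w (rank_of (sp ! i) (\<pi> i))) = \<kappa> ^ card {i. i < n \<and> rank_of (sp ! i) (\<pi> i) < k}"
      by (simp add: w_def prod.If_cases Int_def)
    also have "\<dots> \<ge> \<kappa> powr (\<delta> * n)"
      using that \<kappa> by (simp add: powr_realpow[symmetric] many_low_def powr_mono)
    finally have "1 \<le> \<kappa> powr (- \<delta> * n) * (\<Prod>i<n. w (rank_of (sp ! i) (\<pi> i)))"
      using \<kappa> by (simp add: powr_minus field_simps)
    moreover have "?g sp \<ge> 0" by (rule prod_nonneg) (use g_nonneg[OF that(1)] in auto)
    ultimately have "1 * ?g sp \<le> (\<kappa> powr (- \<delta> * n) * (\<Prod>i<n. w (rank_of (sp ! i) (\<pi> i)))) * ?g sp"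
      by (intro mult_right_mono)
    then show ?thesis by (simp add: prod.distrib mult.assoc)
  qed
  have h_nonneg: "?h i (sp ! i) \<ge> 0" if "sp \<in> profiles n" "i < n" for sp i
    using g_nonneg[OF that] \<kappa> by (auto simp: w_def)
  have "(\<Sum>sp | sp \<in> profiles n \<and> many_low n k \<delta> sp \<pi>. ?g sp)
      \<le> (\<Sum>sp | sp \<in> profiles n \<and> many_low n k \<delta> sp \<pi>. \<kappa> powr (- \<delta> * n) * (\<Prod>i<n. ?h i (sp ! i)))"
    by (intro sum_mono point) auto
  also have "\<dots> \<le> (\<Sum>sp\<in>profiles n. \<kappa> powr (- \<delta> * n) * (\<Prod>i<n. ?h i (sp ! i)))"
  proof (rule sum_mono2[OF fin])
    fix sp assume "sp \<in> profiles n - {sp. sp \<in> profiles n \<and> many_low n k \<delta> sp \<pi>}"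
    then have "(\<Prod>i<n. ?h i (sp ! i)) \<ge> 0" by (intro prod_nonneg ballI h_nonneg) auto
    then show "0 \<le> \<kappa> powr (- \<delta> * n) * (\<Prod>i<n. ?h i (sp ! i))" by simp
  qed auto
  also have "\<dots> = \<kappa> powr (- \<delta> * n) * (\<Prod>i<n. \<Sum>\<sigma>\<in>permutations_of_set {0..<n}. ?h i \<sigma>)"
    by (subst sum_lists_prod[symmetric]) (simp_all add: sum_distrib_left)
  also have "\<dots> \<le> \<kappa> powr (- \<delta> * n) * (\<Prod>i<n. fact (n - 1) * (\<Sum>r<n. w r * a i ^ r))"
  proof (intro mult_left_mono prod_mono conjI)
    fix i assume i: "i \<in> {..<n}"
    have "\<pi> i \<in> {0..<n}" using permutes_in_image[OF \<pi>, of i] i by simp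
    then show "(\<Sum>\<sigma>\<in>permutations_of_set {0..<n}. ?h i \<sigma>) \<le> fact (n - 1) * (\<Sum>r<n. w r * a i ^ r)"
      using sum_permutations_weighted_le[of "{0..<n}" "\<pi> i" y w] y \<kappa>
      by (simp add: a_def w_def)
    show "0 \<le> (\<Sum>\<sigma>\<in>permutations_of_set {0..<n}. ?h i \<sigma>)"
    proof (intro sum_nonneg mult_nonneg_nonneg prod_nonneg)
      show "0 \<le> y s" if "\<sigma> \<in> permutations_of_set {0..<n}" "s \<in> above \<sigma> (\<pi> i)" for \<sigma> s
        using that above_subset[of \<sigma> "\<pi> i"] y[of s] by (auto simp: permutations_of_set_def)
    qed (use \<kappa> in \<open>auto simp: w_def\<close>)
  qed simp
  also have "\<dots> = \<kappa> powr (- \<delta> * n) * fact (n - 1) ^ n * (\<Prod>i<n. \<Sum>r<n. w r * a i ^ r)"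
    by (simp add: prod.distrib)
  finally show ?thesis by (simp add: w_def)
qed

text \<open>Stability of \<open>\<pi>\<close> means that each school ranks its partner
  \<open>inv \<pi> s\<close> above all students who prefer \<open>s\<close> to their match. For
  fixed preferences these are independent conditions on the schools, each of the form treated in
  \<open>card_permutations_first_among\<close>.\<close>

lemma card_stable_priorities:
  assumes \<pi>: "\<pi> permutes {0..<n}"
  shows "real (card {sc \<in> profiles n. \<forall>s<n. above (sc ! s) (inv \<pi> s) \<inter> {i. i < n \<and> s \<in> above (sp ! i) (\<pi> i)} = {}})
     = (\<Prod>s<n. fact n / (1 + real (card {i. i < n \<and> s \<in> above (sp ! i) (\<pi> i)})))"
proof -
  let ?D = "\<lambda>s. {i. i < n \<and> s \<in> above (sp ! i) (\<pi> i)}"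
  have "{sc \<in> profiles n. \<forall>s<n. above (sc ! s) (inv \<pi> s) \<inter> ?D s = {}}
      = {sc. set sc \<subseteq> permutations_of_set {0..<n} \<and> length sc = n \<and>
          (\<forall>s<n. above (sc ! s) (inv \<pi> s) \<inter> ?D s = {})}" by auto
  then have "real (card {sc \<in> profiles n. \<forall>s<n. above (sc ! s) (inv \<pi> s) \<inter> ?D s = {}})
      = (\<Prod>s<n. real (card {\<sigma>\<in>permutations_of_set {0..<n}. above \<sigma> (inv \<pi> s) \<inter> ?D s = {}}))"
    using card_lists_pointwise[of "permutations_of_set {0..<n}" n
        "\<lambda>s \<sigma>. above \<sigma> (inv \<pi> s) \<inter> ?D s = {}"] by simp
  also have "\<dots> = (\<Prod>s<n. fact n / (1 + real (card (?D s))))"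
  proof (rule prod.cong[OF refl])
    fix s assume "s \<in> {..<n}"
    then have inv: "inv \<pi> s \<in> {0..<n}" using permutes_in_image[OF permutes_inv[OF \<pi>], of s] by simp
    have "inv \<pi> s \<notin> ?D s" using permutes_inverses[OF \<pi>] not_in_above_self[of s] by auto
    then have "?D s \<subseteq> {0..<n} - {inv \<pi> s}" by auto
    then show "real (card {\<sigma>\<in>permutations_of_set {0..<n}. above \<sigma> (inv \<pi> s) \<inter> ?D s = {}})
        = fact n / (1 + real (card (?D s)))"
      using card_permutations_first_among[OF _ inv] by simp
  qed
  finally show ?thesis .
qed

text \<open>First moment: the outcome of deferred acceptance is one of the stable matchings, so
  problems are bounded by pairs of a problem and a stable matching with many top choices.\<close>

lemma card_many_low_le:
  "real (card {P\<in>problems n. many_low n k \<delta> (fst P) (DA n P)})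
   \<le> (\<Sum>\<pi> | \<pi> permutes {0..<n}. \<Sum>sp | sp \<in> profiles n \<and> many_low n k \<delta> sp \<pi>.
        \<Prod>s<n. fact n / (1 + real (card {i. i < n \<and> s \<in> above (sp ! i) (\<pi> i)})))"
  (is "real (card ?S) \<le> _")
proof -
  let ?D = "\<lambda>\<pi> sp s. {i. i < n \<and> s \<in> above (sp ! i) (\<pi> i)}"
  let ?Q = "\<lambda>\<pi>. {sp. sp \<in> profiles n \<and> many_low n k \<delta> sp \<pi>}"
  let ?R = "\<lambda>\<pi> sp. {sc \<in> profiles n. \<forall>s<n. above (sc ! s) (inv \<pi> s) \<inter> ?D \<pi> sp s = {}}"
  have finQ: "finite (?Q \<pi>)" for \<pi>
    by (rule finite_subset[OF _ finite_profiles[of n]]) auto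
  have finR: "finite (?R \<pi> sp)" for \<pi> sp
    by (rule finite_subset[OF _ finite_profiles[of n]]) auto
  have finp: "finite {\<pi>. \<pi> permutes {0..<n}}" by (simp add: finite_permutations)
  have "?S \<subseteq> (\<Union>\<pi>\<in>{\<pi>. \<pi> permutes {0..<n}}. Sigma (?Q \<pi>) (?R \<pi>))"
  proof
    fix P assume "P \<in> ?S"
    then have P: "P \<in> problems n" and low: "many_low n k \<delta> (fst P) (DA n P)" by auto
    \<comment> \<open>\<open>permutes\<close> requires the identity outside \<open>{0..<n}\<close>,
      where \<open>DA\<close> is arbitrary.\<close>
    define \<pi> where "\<pi> i = (if i \<in> {0..<n} then DA n P i else i)" for i
    have "bij_betw \<pi> {0..<n} {0..<n}"
      using DA_bij[OF P] by (rule bij_betw_cong[THEN iffD1, rotated]) (simp add: \<pi>_def)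
    then have \<pi>: "\<pi> permutes {0..<n}"
      by (rule bij_imp_permutes) (auto simp: \<pi>_def)
    have "many_low n k \<delta> (fst P) \<pi>"
    proof -
      have "{i. i < n \<and> rank_of (fst P ! i) (\<pi> i) < k} = {i. i < n \<and> rank_of (fst P ! i) (DA n P i) < k}"
        by (auto simp: \<pi>_def)
      then show ?thesis using low by (simp add: many_low_def)
    qed
    moreover have "above (snd P ! s) (inv \<pi> s) \<inter> ?D \<pi> (fst P) s = {}" if s: "s < n" for s
    proof -
      have j: "inv \<pi> s < n" using permutes_in_image[OF permutes_inv[OF \<pi>], of s] s by simp
      have "\<pi> (inv \<pi> s) = s" using permutes_inverses[OF \<pi>] by simp
      then have DAj: "DA n P (inv \<pi> s) = s" using j by (simp add: \<pi>_def)
      show ?thesis using DA_stable[OF P _ j] unfolding DAj by (auto simp: \<pi>_def)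
    qed
    ultimately have "P \<in> Sigma (?Q \<pi>) (?R \<pi>)"
      using P by (cases P) (auto simp: problems_eq)
    then show "P \<in> (\<Union>\<pi>\<in>{\<pi>. \<pi> permutes {0..<n}}. Sigma (?Q \<pi>) (?R \<pi>))" using \<pi> by blast
  qed
  then have "card ?S \<le> card (\<Union>\<pi>\<in>{\<pi>. \<pi> permutes {0..<n}}. Sigma (?Q \<pi>) (?R \<pi>))"
    by (intro card_mono finite_UN_I finp finite_SigmaI finQ finR)
  also have "\<dots> \<le> (\<Sum>\<pi> | \<pi> permutes {0..<n}. card (Sigma (?Q \<pi>) (?R \<pi>)))"
    by (rule card_UN_le[OF finp])
  also have "\<dots> = (\<Sum>\<pi> | \<pi> permutes {0..<n}. \<Sum>sp\<in>?Q \<pi>. card (?R \<pi> sp))"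
    using finQ finR by (intro sum.cong refl card_SigmaI) auto
  finally have "real (card ?S) \<le> (\<Sum>\<pi> | \<pi> permutes {0..<n}. \<Sum>sp\<in>?Q \<pi>. real (card (?R \<pi> sp)))"
    by (simp flip: of_nat_sum)
  also have "\<dots> = (\<Sum>\<pi> | \<pi> permutes {0..<n}. \<Sum>sp\<in>?Q \<pi>. \<Prod>s<n. fact n / (1 + real (card (?D \<pi> sp s))))"
    by (intro sum.cong refl card_stable_priorities) auto
  finally show ?thesis .
qed

text \<open>Expanding a product of averages gives an average over grid functions \<open>u\<close>,
  that is, over independent values \<open>y\<close>, one per school.\<close>

lemma prod_inverse_Suc_le:
  assumes "M > 0"
  shows "(\<Prod>s<n. 1 / (1 + real (d s)))
     \<le> (\<Sum>u\<in>{..<n} \<rightarrow>\<^sub>E {..<M}. \<Prod>s<n. (1 - real (u s) / real M) ^ d s) / real M ^ n"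
proof -
  have "(\<Prod>s<n. 1 / (1 + real (d s))) \<le> (\<Prod>s<n. (\<Sum>v<M. (1 - real v / real M) ^ d s) / real M)"
    by (intro prod_mono conjI inverse_Suc_le_Riemann_sum assms) auto
  also have "\<dots> = (\<Prod>s<n. \<Sum>v<M. (1 - real v / real M) ^ d s) / real M ^ n"
    by (simp add: prod_dividef)
  also have "(\<Prod>s<n. \<Sum>v<M. (1 - real v / real M) ^ d s)
      = (\<Sum>u\<in>{..<n} \<rightarrow>\<^sub>E {..<M}. \<Prod>s<n. (1 - real (u s) / real M) ^ d s)"
    by (rule prod_sum_PiE) auto
  finally show ?thesis .
qed

text \<open>Double counting of the pairs \<open>(i, s)\<close> with \<open>s \<in> B i\<close>. With
  \<open>B i\<close> the schools that student \<open>i\<close> prefers to her match, a product over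
  schools becomes a product over students, whose lists are independent.\<close>

lemma prod_power_card_swap:
  fixes y :: "nat \<Rightarrow> real" and n :: nat
  assumes "\<And>i. i < n \<Longrightarrow> B i \<subseteq> {..<m}"
  shows "(\<Prod>s<m. y s ^ card {i. i < n \<and> s \<in> B i}) = (\<Prod>i<n. \<Prod>s\<in>B i. y s)"
proof -
  have "(\<Prod>s<m. y s ^ card {i. i < n \<and> s \<in> B i}) = (\<Prod>s<m. \<Prod>i<n. if s \<in> B i then y s else 1)"
  proof (rule prod.cong[OF refl])
    fix s
    show "y s ^ card {i. i < n \<and> s \<in> B i} = (\<Prod>i<n. if s \<in> B i then y s else 1)"
      using prod.inter_filter[of "{..<n}" "\<lambda>_. y s" "\<lambda>i. s \<in> B i"] by simp
  qed
  also have "\<dots> = (\<Prod>i<n. \<Prod>s<m. if s \<in> B i then y s else 1)"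
    by (rule prod.swap)
  also have "\<dots> = (\<Prod>i<n. \<Prod>s\<in>B i. y s)"
  proof (rule prod.cong[OF refl])
    fix i assume "i \<in> {..<n}"
    then have "{s\<in>{..<m}. s \<in> B i} = B i" using assms by auto
    then show "(\<Prod>s<m. if s \<in> B i then y s else 1) = (\<Prod>s\<in>B i. y s)"
      using prod.inter_filter[of "{..<m}" y "\<lambda>s. s \<in> B i"] by simp
  qed
  finally show ?thesis .
qed

section \<open>Estimates for geometric series, the grid of parameters \<open>\<theta>\<close>, and
  factorials\<close>

lemma sum_geometric_le:
  fixes a :: real
  assumes "0 \<le> a" "a < 1"
  shows "(\<Sum>r<n. a ^ r) \<le> 1 / (1 - a)"
  using assms by (simp add: sum_gp_strict divide_right_mono)

text \<open>Only the first \<open>k\<close> terms carry the additional weight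
  \<open>\<kappa> - 1\<close>, and their powers of \<open>a\<close> are at most 1.\<close>

lemma weighted_sum_geometric_le:
  fixes a \<kappa> :: real
  assumes "0 \<le> a" "a \<le> 1" "\<kappa> \<ge> 1"
  shows "(\<Sum>r<n. (if r < k then \<kappa> else 1) * a ^ r) \<le> (\<kappa> - 1) * k + (\<Sum>r<n. a ^ r)"
proof -
  have "(\<Sum>r<n. (if r < k then \<kappa> else 1) * a ^ r) = (\<Sum>r<n. (if r < k then (\<kappa> - 1) * a ^ r else 0) + a ^ r)"
    by (intro sum.cong) (auto simp: algebra_simps)
  also have "\<dots> = (\<Sum>r\<in>{..<n} \<inter> {..<k}. (\<kappa> - 1) * a ^ r) + (\<Sum>r<n. a ^ r)"
    by (simp add: sum.distrib sum.If_cases lessThan_def)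
  also have "(\<Sum>r\<in>{..<n} \<inter> {..<k}. (\<kappa> - 1) * a ^ r) \<le> (\<Sum>r\<in>{..<n} \<inter> {..<k}. (\<kappa> - 1))"
    using assms by (intro sum_mono) (simp add: mult_left_le power_le_one)
  also have "\<dots> \<le> (\<kappa> - 1) * k"
  proof -
    have "card ({..<n} \<inter> {..<k}) \<le> k" using card_mono[of "{..<k}" "{..<n} \<inter> {..<k}"] by simp
    then have "real (card ({..<n} \<inter> {..<k})) * (\<kappa> - 1) \<le> real k * (\<kappa> - 1)"
      using assms by (intro mult_right_mono) auto
    then show ?thesis by (simp add: mult.commute)
  qed
  finally show ?thesis by simp
qed

text \<open>The function \<open>\<theta> \<mapsto> \<theta> exp (-\<theta> s)\<close> has maximum \<open>1 / (e s)\<close>, attained at \<open>\<theta> = 1 / s\<close>;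
  a grid of mesh \<open>\<gamma>\<close> loses at most the factor \<open>1 + \<gamma>\<close>.\<close>
lemma grid_point:
  fixes x s \<gamma> :: real
  assumes "1 \<le> x" "x \<le> real n" "\<gamma> > 0" "s \<le> 1 / x"
  obtains l where "l \<le> nat \<lfloor>real n / \<gamma>\<rfloor>" "1 + \<gamma> * real l \<le> x"
    "x \<le> exp 1 * (1 + \<gamma>) * ((1 + \<gamma> * real l) * exp (- (1 + \<gamma> * real l) * s))"
proof -
  \<comment> \<open>The index of the largest grid point \<open>1 + \<gamma> * l\<close> that does
    not exceed \<open>x\<close>.\<close>
  define l where "l = nat \<lfloor>(x - 1) / \<gamma>\<rfloor>"
  have nn: "0 \<le> (x - 1) / \<gamma>" using assms by simp
  have l_le: "real l \<le> (x - 1) / \<gamma>" using nn unfolding l_def by linarith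
  have l_gt: "(x - 1) / \<gamma> < real l + 1" using nn unfolding l_def by linarith
  let ?t = "1 + \<gamma> * real l"
  have t1: "?t \<ge> 1" using assms by simp
  have tx: "?t \<le> x" using l_le assms by (simp add: field_simps)
  have "x - 1 < \<gamma> * (real l + 1)" using l_gt assms by (simp add: field_simps)
  then have "x \<le> ?t + \<gamma>" by (simp add: algebra_simps)
  \<comment> \<open>The grid starts at 1, so the additive error \<open>\<gamma>\<close> is also a
    relative error.\<close>
  also have "\<dots> \<le> (1 + \<gamma>) * ?t" using t1 assms by (simp add: algebra_simps)
  finally have x_le: "x \<le> (1 + \<gamma>) * ?t" .
  have "?t * s \<le> ?t * (1 / x)" using assms t1 by (intro mult_left_mono) auto
  also have "\<dots> \<le> 1" using tx assms by simp
  finally have "?t * s \<le> 1" .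
  then have "0 \<le> 1 + - ?t * s" by (simp only: mult_minus_left add_uminus_conv_diff diff_ge_0_iff_ge)
  then have "1 \<le> exp (1 + - ?t * s)" by (simp only: one_le_exp_iff)
  then have "1 \<le> exp 1 * exp (- ?t * s)" by (simp only: exp_add)
  then have "(1 + \<gamma>) * ?t * 1 \<le> (1 + \<gamma>) * ?t * (exp 1 * exp (- ?t * s))"
    using t1 assms by (intro mult_left_mono) auto
  then have "x \<le> exp 1 * (1 + \<gamma>) * (?t * exp (- ?t * s))" using x_le by (simp add: mult_ac)
  moreover have "l \<le> nat \<lfloor>real n / \<gamma>\<rfloor>"
    unfolding l_def using assms by (intro nat_mono floor_mono divide_right_mono) auto
  ultimately show ?thesis using that[of l] tx by blast
qed

text \<open>The left side is a Riemann sum for the integral of \<open>t * exp (- t * x)\<close> over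
  \<open>[0, 1]\<close>, which is \<open>1 - exp (- t)\<close>. Summing it as a geometric series,
  \<open>1 + h \<le> exp h\<close> with \<open>h = t / M\<close> bounds the discretisation error by
  the factor \<open>exp h\<close>.\<close>

lemma sum_exp_grid_le:
  fixes t :: real
  assumes "t > 0" "M > 0"
  shows "t * (\<Sum>v<M. exp (- t * real v / real M)) / M \<le> (1 - exp (- t)) * exp (t / M)"
proof -
  let ?x = "exp (- (t / M))"
  have x1: "?x < 1" using assms by simp
  have "1 + t / M \<le> exp (t / M)" by (rule exp_ge_add_one_self)
  then have "(1 + t / M) * ?x \<le> exp (t / M) * ?x" by (intro mult_right_mono) auto
  then have key: "t / M * ?x \<le> 1 - ?x" by (simp add: exp_minus algebra_simps)
  have "exp (- t * real v / real M) = ?x ^ v" for v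
    by (simp add: exp_of_nat_mult[symmetric] mult.commute)
  then have "(\<Sum>v<M. exp (- t * real v / real M)) = (1 - ?x ^ M) / (1 - ?x)"
    using x1 assms by (simp add: sum_gp_strict)
  also have "?x ^ M = exp (- t)" using assms by (simp add: exp_of_nat_mult[symmetric])
  finally have "t * (\<Sum>v<M. exp (- t * real v / real M)) / M = (1 - exp (- t)) * ((t / M) / (1 - ?x))"
    by (simp add: mult_ac)
  also have "\<dots> \<le> (1 - exp (- t)) * exp (t / M)"
  proof (intro mult_left_mono)
    have "exp (t / M) * (t / M * ?x) = t / M" by (simp add: exp_minus)
    moreover have "exp (t / M) * (t / M * ?x) \<le> exp (t / M) * (1 - ?x)"
      by (intro mult_left_mono key) simp
    ultimately have "t / M \<le> exp (t / M) * (1 - ?x)" by (simp only:)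
    then show "t / M / (1 - ?x) \<le> exp (t / M)"
      by (rule pos_divide_le_eq[THEN iffD2, rotated]) (use x1 in linarith)
  qed (use assms in simp)
  finally show ?thesis .
qed

text \<open>The induction step is \<open>(1 - 1 / (n + 1)) ^ (n + 1) \<le> exp (- 1)\<close>.
  Compared with Stirling's formula the loss is only polynomial.\<close>

lemma fact_le_exp: "n > 0 \<Longrightarrow> fact n * exp (real n) \<le> exp 1 * real n * real n ^ n"
proof (induction n rule: nat_induct_non_zero)
  case 1
  then show ?case by simp
next
  case (Suc n)
  have "1 + - (1 / real (Suc n)) \<le> exp (- (1 / real (Suc n)))" by (rule exp_ge_add_one_self)
  then have "(real n / real (Suc n)) ^ Suc n \<le> exp (- (1 / real (Suc n))) ^ Suc n"
    by (intro power_mono) (auto simp: field_simps)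
  also have "\<dots> = exp (- 1)" by (simp add: exp_of_nat_mult[symmetric] del: power_Suc of_nat_Suc)
  finally have "real n ^ Suc n \<le> exp (- 1) * real (Suc n) ^ Suc n"
    by (simp add: power_divide divide_le_eq del: power_Suc of_nat_Suc)
  then have *: "exp 1 * real n ^ Suc n \<le> real (Suc n) ^ Suc n"
    using mult_left_mono[of _ _ "exp 1 :: real"] by (fastforce simp: exp_minus field_simps)
  have "fact (Suc n) * exp (real (Suc n)) = real (Suc n) * exp 1 * (fact n * exp (real n))"
    by (simp add: exp_add algebra_simps)
  also have "\<dots> \<le> real (Suc n) * exp 1 * (exp 1 * real n * real n ^ n)"
    using Suc by (intro mult_left_mono) auto
  also have "\<dots> = real (Suc n) * exp 1 * (exp 1 * real n ^ Suc n)" by simp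
  also have "\<dots> \<le> real (Suc n) * exp 1 * real (Suc n) ^ Suc n"
    using * by (intro mult_left_mono) auto
  finally show ?case by (simp add: mult_ac)
qed

text \<open>For fixed \<open>y\<close> each student contributes a geometric series of value about
  \<open>1 / s\<close>. For \<open>s \<ge> \<eta>\<close> the weight \<open>\<kappa> = 1\<close>
  suffices, and a grid point \<open>\<theta> l \<le> 1 / \<eta>\<close> reproduces
  \<open>1 / (e * s)\<close> up to a factor \<open>1 + \<gamma>\<close>. For smaller
  \<open>s\<close> a constant factor per student is lost, but a large \<open>\<kappa>\<close> turns
  the many top choices into the small factor \<open>(k * \<eta>) powr \<delta>\<close>. The best
  \<open>\<theta>\<close> depends on \<open>y\<close>, whereas the later averaging over
  \<open>y\<close> needs it fixed; hence the sum over all \<open>l\<close>.\<close>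

lemma sum_profiles_many_low_grid_le:
  fixes y :: "nat \<Rightarrow> real" and \<delta> \<eta> \<gamma> :: real
  assumes \<pi>: "\<pi> permutes {0..<n}" and y: "\<And>s. s < n \<Longrightarrow> 0 \<le> y s \<and> y s \<le> 1"
    and pos: "\<eta> > 0" "\<gamma> > 0" "k > 0" and k\<eta>: "real k * \<eta> \<le> 1"
    and n_big: "(1 + \<gamma>) / (\<gamma> * \<eta>) \<le> real n"
  defines "s \<equiv> (\<Sum>j<n. 1 - y j) / n" and "\<theta> \<equiv> \<lambda>l::nat. 1 + \<gamma> * real l"
  shows "(\<Sum>sp | sp \<in> profiles n \<and> many_low n k \<delta> sp \<pi>. \<Prod>i<n. \<Prod>j\<in>above (sp ! i) (\<pi> i). y j)
     \<le> fact (n - 1) ^ n * (\<Sum>l\<le>nat \<lfloor>n / \<gamma>\<rfloor>.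
          ((if \<theta> l \<le> 1 / \<eta> then ((1 + \<gamma>)\<^sup>2) ^ n else 0) + n * (3 * (1 + \<gamma>) * (k * \<eta>) powr \<delta>) ^ n)
          * (exp 1 * (\<theta> l * exp (- \<theta> l * s))) ^ n)"
    (is "?S \<le> _ * (\<Sum>l\<le>?L. ?T l)")
proof -
  define Z where "Z = (\<Sum>j<n. 1 - y j)"
  define z where "z i = 1 - y (\<pi> i)" for i
  define a where "a i = (\<Sum>j\<in>{0..<n} - {\<pi> i}. y j) / real (n - 1)" for i
  define G where "G i = (\<Sum>r<n. a i ^ r)" for i
  have "1 * \<eta> \<le> real k * \<eta>" using pos by (intro mult_right_mono) auto
  then have \<eta>1: "\<eta> \<le> 1" using k\<eta> by linarith
  have n_gt: "1 / \<eta> < n"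
  proof -
    have "1 / \<eta> < (1 + \<gamma>) / (\<gamma> * \<eta>)" using pos by (simp add: field_simps)
    then show ?thesis using n_big by linarith
  qed
  moreover have "1 / \<eta> \<ge> 1" using \<eta>1 pos by simp
  ultimately have n2: "n \<ge> 2" by linarith
  have \<pi>_in: "\<pi> i < n" if "i < n" for i using permutes_in_image[OF \<pi>, of i] that by simp
  have z01: "0 \<le> z i" "z i \<le> 1" if "i < n" for i using y[OF \<pi>_in[OF that]] by (auto simp: z_def)
  have Z_sum: "Z = (\<Sum>i<n. z i)"
    unfolding Z_def z_def using sum.permute[OF \<pi>, of "\<lambda>j. 1 - y j"] by (simp add: atLeast0LessThan comp_def)
  have Z0: "0 \<le> Z" unfolding Z_sum using z01 by (intro sum_nonneg) auto
  have Zn: "Z \<le> n" unfolding Z_sum using sum_mono[of "{..<n}" z "\<lambda>_. 1"] z01 by simp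
  have zZ: "z i \<le> Z" if "i < n" for i
    unfolding Z_sum using that z01 by (intro member_le_sum) auto
  have a_eq: "1 - a i = (Z - z i) / (real n - 1)" if "i < n" for i
  proof -
    have "(\<Sum>j\<in>{0..<n} - {\<pi> i}. y j) = (\<Sum>j<n. y j) - y (\<pi> i)"
      using \<pi>_in[OF that] by (simp add: sum_diff1 atLeast0LessThan)
    moreover have "(\<Sum>j<n. y j) = n - Z" unfolding Z_def by (simp add: sum_subtractf)
    ultimately have "a i = (real n - 1 - (Z - z i)) / (real n - 1)"
      using n2 by (simp add: a_def z_def of_nat_diff)
    then show ?thesis using n2 by (simp add: field_simps)
  qed
  have a1: "a i \<le> 1" if "i < n" for i
  proof -
    have "0 \<le> (Z - z i) / (real n - 1)" using zZ[OF that] n2 by (intro divide_nonneg_nonneg) auto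
    then show ?thesis using a_eq[OF that] by linarith
  qed
  have a0: "0 \<le> a i" for i
    unfolding a_def using y by (intro divide_nonneg_nonneg sum_nonneg) auto
  have G_n: "G i \<le> n" if "i < n" for i
    unfolding G_def using sum_mono[of "{..<n}" "\<lambda>r. a i ^ r" "\<lambda>_. 1"] a0[of i] a1[OF that]
    by (simp add: power_le_one)
  have G_le: "G i \<le> (real n - 1) / (Z - z i)" if "i < n" "z i < Z" for i
  proof -
    have "0 < (Z - z i) / (real n - 1)" using that n2 by (intro divide_pos_pos) auto
    then have "a i < 1" using a_eq[OF that(1)] by linarith
    then have "G i \<le> 1 / (1 - a i)" unfolding G_def by (rule sum_geometric_le[OF a0])
    then show ?thesis using a_eq[OF that(1)] by simp
  qed
  have G0: "0 \<le> G i" for i unfolding G_def using a0 by (intro sum_nonneg) auto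
  have S_le: "?S \<le> \<kappa> powr (- \<delta> * n) * fact (n - 1) ^ n * (\<Prod>i<n. (\<kappa> - 1) * k + G i)" if "\<kappa> \<ge> 1" for \<kappa>
  proof -
    have "?S \<le> \<kappa> powr (- \<delta> * n) * fact (n - 1) ^ n * (\<Prod>i<n. \<Sum>r<n. (if r < k then \<kappa> else 1) * a i ^ r)"
      unfolding a_def using \<pi> y that by (intro sum_profiles_many_low_le) auto
    also have "\<dots> \<le> \<kappa> powr (- \<delta> * n) * fact (n - 1) ^ n * (\<Prod>i<n. (\<kappa> - 1) * k + G i)"
      unfolding G_def using a0 a1 that
      by (intro mult_left_mono prod_mono conjI weighted_sum_geometric_le sum_nonneg) auto
    finally show ?thesis .
  qed
  have \<theta>0: "0 \<le> \<theta> l" for l using pos by (simp add: \<theta>_def)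
  have T0: "0 \<le> ?T l" for l
    using \<theta>0 pos by (intro mult_nonneg_nonneg add_nonneg_nonneg zero_le_power) auto
  \<comment> \<open>All summands are nonnegative, so exhibiting a single suitable \<open>l\<close>
    is enough.\<close>
  have T_le: "?T l \<le> (\<Sum>l\<le>?L. ?T l)" if "l \<le> ?L" for l
    using that T0 by (intro member_le_sum) auto
  have s_eq: "s = Z / n" by (simp add: s_def Z_def)
  show ?thesis
  proof (cases "\<eta> * n \<le> Z")
    case True
    have "\<eta> * n \<ge> (1 + \<gamma>) / \<gamma>" using n_big pos by (simp add: field_simps)
    then have "Z \<ge> (1 + \<gamma>) / \<gamma>" using True by linarith
    \<comment> \<open>A student's series omits her own school, which lowers \<open>Z\<close> by at
      most 1. The hypothesis on \<open>n\<close> makes \<open>Z\<close> so large that this costs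
      only a factor \<open>1 + \<gamma>\<close>.\<close>
    then have Z_big: "Z \<le> (1 + \<gamma>) * (Z - 1)" using pos by (simp add: field_simps)
    have "(1 + \<gamma>) / \<gamma> > 1" using pos by (simp add: field_simps)
    then have Z1: "Z > 1" using \<open>Z \<ge> (1 + \<gamma>) / \<gamma>\<close> by linarith
    define x where "x = n / Z"
    have x: "1 \<le> x" "x \<le> 1 / \<eta>" "s \<le> 1 / x"
      using Zn Z1 True pos by (auto simp: x_def s_eq field_simps)
    then obtain l where l: "l \<le> ?L" "\<theta> l \<le> x" "x \<le> exp 1 * (1 + \<gamma>) * (\<theta> l * exp (- \<theta> l * s))"
      using grid_point[of x n \<gamma> s] n_gt pos unfolding \<theta>_def by (metis less_le_trans less_imp_le order_trans)
    have G_x: "G i \<le> (1 + \<gamma>) * x" if "i < n" for i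
    proof -
      have "G i \<le> (real n - 1) / (Z - z i)" using G_le[OF that] z01[OF that] Z1 by simp
      also have "\<dots> \<le> n / (Z - 1)" using z01[OF that] Z1 n2 by (intro frac_le) auto
      also have "\<dots> \<le> (1 + \<gamma>) * x"
      proof -
        have "n * Z \<le> n * ((1 + \<gamma>) * (Z - 1))" using Z_big by (intro mult_left_mono) auto
        then show ?thesis using Z1 unfolding x_def by (simp add: field_simps)
      qed
      finally show ?thesis .
    qed
    have "(\<Prod>i<n. G i) \<le> (\<Prod>i<n. (1 + \<gamma>) * x)" using G_x G0 by (intro prod_mono) auto
    also have "\<dots> \<le> ((1 + \<gamma>) * (exp 1 * (1 + \<gamma>) * (\<theta> l * exp (- \<theta> l * s)))) ^ n"
      using l x pos by (simp only: prod_constant card_lessThan) (intro power_mono mult_left_mono, auto)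
    also have "\<dots> = ((1 + \<gamma>)\<^sup>2) ^ n * (exp 1 * (\<theta> l * exp (- \<theta> l * s))) ^ n"
      unfolding power_mult_distrib[symmetric] by (simp add: power2_eq_square mult_ac)
    also have "\<dots> \<le> ?T l"
      using l(2) x(2) \<theta>0[of l] pos by (intro mult_right_mono) auto
    also have "\<dots> \<le> (\<Sum>l\<le>?L. ?T l)" by (rule T_le[OF l(1)])
    finally have "(\<Prod>i<n. G i) \<le> (\<Sum>l\<le>?L. ?T l)" .
    moreover have "?S \<le> fact (n - 1) ^ n * (\<Prod>i<n. G i)" using S_le[of 1] by simp
    ultimately show ?thesis by (meson fact_ge_zero mult_left_mono order_trans zero_le_power)
  next
    case False
    \<comment> \<open>The mean \<open>s\<close> may be 0; the cutoff keeps \<open>x \<le> n\<close>,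
      in line with the trivial bound \<open>G i \<le> n\<close>.\<close>
    define s' where "s' = max s (1 / n)"
    define x where "x = 1 / s'"
    have s'pos: "s' > 0" using n2 by (simp add: s'_def less_max_iff_disj)
    have s'\<eta>: "s' \<le> \<eta>" using False n_gt n2 pos by (auto simp: s'_def s_eq field_simps)
    have x: "1 \<le> x" "x \<le> n" "1 / \<eta> \<le> x" "s \<le> 1 / x"
      using s'pos s'\<eta> \<eta>1 pos n2 by (auto simp: x_def s'_def field_simps max_def)
    then obtain l where l: "l \<le> ?L" "x \<le> exp 1 * (1 + \<gamma>) * (\<theta> l * exp (- \<theta> l * s))"
      using grid_point[of x n \<gamma> s] pos unfolding \<theta>_def by metis
    \<comment> \<open>With this value the additional weight \<open>(\<kappa> - 1) * k\<close> stays
      below \<open>1 / \<eta> \<le> x\<close>, so it is no larger than the bound on the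
      series.\<close>
    define \<kappa> where "\<kappa> = 1 / (k * \<eta>)"
    have k\<eta>0: "k * \<eta> > 0" using pos by simp
    have \<kappa>1: "\<kappa> \<ge> 1" using k\<eta> k\<eta>0 by (simp add: \<kappa>_def)
    have \<kappa>k: "(\<kappa> - 1) * k \<le> x"
    proof -
      have "(\<kappa> - 1) * k \<le> \<kappa> * k" by (simp add: algebra_simps)
      also have "\<dots> = 1 / \<eta>" using pos by (simp add: \<kappa>_def)
      finally show ?thesis using x by linarith
    qed
    \<comment> \<open>The students whose own school carries more than half of \<open>Z\<close>, so
      that omitting it could destroy the series bound. There is at most one of them, and the bound
      \<open>n\<close> for her costs only a polynomial factor.\<close>
    define X where "X = {i. i < n \<and> Z < 2 * z i}"
    have finX: "finite X" by (simp add: X_def)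
    have "card X \<le> 1"
    proof (rule ccontr)
      assume "\<not> card X \<le> 1"
      then obtain i j where ij: "i \<in> X" "j \<in> X" "i \<noteq> j" using finX by (metis card_le_Suc0_iff_eq One_nat_def)
      have "(\<Sum>i\<in>{i, j}. z i) \<le> Z"
        unfolding Z_sum using ij z01 by (intro sum_mono2) (auto simp: X_def)
      then show False using ij by (auto simp: X_def)
    qed
    have factor: "(\<kappa> - 1) * k + G i \<le> 3 * x * (if i \<in> X then n else 1)" if i: "i < n" for i
    proof (cases "i \<in> X")
      case True
      have "real n * 1 \<le> n * x" "1 * x \<le> n * x"
        using x n2 by (intro mult_left_mono mult_right_mono; simp)+
      then have "x + n \<le> 3 * x * n" by (simp add: algebra_simps)
      then show ?thesis using True G_n[OF i] \<kappa>k by simp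
    next
      case False
      have "G i \<le> 2 * x"
      proof (cases "Z \<le> 1")
        case True
        then have "s' = 1 / n" using n2 by (simp add: s'_def s_eq max_def divide_right_mono)
        then have "x = n" by (simp add: x_def)
        then show ?thesis using G_n[OF i] by simp
      next
        case Z: False
        have half: "z i \<le> Z / 2" using False i by (simp add: X_def)
        have "s' = Z / n" using Z n2 by (simp add: s'_def s_eq max_def field_simps)
        then have x_eq: "x = n / Z" by (simp add: x_def)
        have "G i \<le> (real n - 1) / (Z - z i)" using G_le[OF i] half Z by simp
        also have "\<dots> \<le> n / (Z / 2)" using half Z n2 by (intro frac_le) auto
        finally show ?thesis by (simp add: x_eq mult.commute)
      qed
      then show ?thesis using False \<kappa>k by simp
    qed
    have "(\<Prod>i<n. (\<kappa> - 1) * k + G i) \<le> (\<Prod>i<n. 3 * x * (if i \<in> X then n else 1))"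
      using factor \<kappa>1 G0 by (intro prod_mono) auto
    also have "\<dots> = (3 * x) ^ n * real n ^ card X"
    proof -
      have "{..<n} \<inter> X = X" by (auto simp: X_def)
      then show ?thesis by (simp add: prod.distrib prod.If_cases power_mult_distrib if_distrib[of real])
    qed
    also have "\<dots> \<le> (3 * x) ^ n * n"
    proof (intro mult_left_mono)
      show "real n ^ card X \<le> n" using power_increasing[OF \<open>card X \<le> 1\<close>, of "real n"] n2 by simp
    qed (use x in simp)
    also have "\<dots> \<le> (3 * (exp 1 * (1 + \<gamma>) * (\<theta> l * exp (- \<theta> l * s)))) ^ n * n"
      using l x by (intro mult_right_mono power_mono) auto
    also have "\<dots> = n * (3 * (1 + \<gamma>)) ^ n * (exp 1 * (\<theta> l * exp (- \<theta> l * s))) ^ n"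
      by (simp only: power_mult_distrib mult_ac)
    finally have P: "(\<Prod>i<n. (\<kappa> - 1) * k + G i) \<le> n * (3 * (1 + \<gamma>)) ^ n * (exp 1 * (\<theta> l * exp (- \<theta> l * s))) ^ n" .
    have \<kappa>\<delta>: "\<kappa> powr (- \<delta> * n) = ((k * \<eta>) powr \<delta>) ^ n"
    proof -
      have "\<kappa> powr (- \<delta> * n) = (k * \<eta>) powr (\<delta> * n)"
        using k\<eta>0 by (simp add: \<kappa>_def powr_divide powr_minus_divide)
      also have "\<dots> = ((k * \<eta>) powr \<delta>) powr n" by (simp add: powr_powr)
      also have "\<dots> = ((k * \<eta>) powr \<delta>) ^ n"
        by (rule powr_realpow) (use pos in simp)
      finally show ?thesis .
    qed
    have "?S \<le> fact (n - 1) ^ n * (((k * \<eta>) powr \<delta>) ^ n * (\<Prod>i<n. (\<kappa> - 1) * k + G i))"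
      using S_le[OF \<kappa>1] unfolding \<kappa>\<delta> by (simp only: mult_ac)
    also have "\<dots> \<le> fact (n - 1) ^ n * (((k * \<eta>) powr \<delta>) ^ n *
        (n * (3 * (1 + \<gamma>)) ^ n * (exp 1 * (\<theta> l * exp (- \<theta> l * s))) ^ n))"
      using P by (intro mult_left_mono) auto
    also have "\<dots> = fact (n - 1) ^ n * (n * (3 * (1 + \<gamma>) * (k * \<eta>) powr \<delta>) ^ n * (exp 1 * (\<theta> l * exp (- \<theta> l * s))) ^ n)"
      by (simp only: power_mult_distrib mult_ac)
    also have "\<dots> \<le> fact (n - 1) ^ n * ?T l"
      using \<theta>0[of l] pos by (intro mult_left_mono mult_right_mono) auto
    also have "\<dots> \<le> fact (n - 1) ^ n * (\<Sum>l\<le>?L. ?T l)"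
      by (intro mult_left_mono T_le l) auto
    finally show ?thesis .
  qed
qed

text \<open>The bounds for fixed \<open>y\<close> are averaged over the grid, separately for each
  \<open>l\<close>, and then summed over all \<open>n!\<close> matchings. The first term of the
  result comes from \<open>s \<ge> \<eta>\<close>, the second from
  \<open>s < \<eta>\<close>.\<close>

lemma card_many_low_problems_le:
  fixes \<delta> \<eta> \<gamma> :: real
  assumes pos: "\<eta> > 0" "\<gamma> > 0" "k > 0" and k\<eta>: "real k * \<eta> \<le> 1"
    and n_big: "(1 + \<gamma>) / (\<gamma> * \<eta>) \<le> real n" and n0: "n > 0"
  shows "real (card {P\<in>problems n. many_low n k \<delta> (fst P) (DA n P)})
     \<le> card (problems n) * (exp 3 * n * (n / \<gamma> + 1) *
         (((1 + \<gamma>)\<^sup>2 * (1 - exp (- (1 / \<eta>)))) ^ n + n * (3 * (1 + \<gamma>) * (k * \<eta>) powr \<delta>) ^ n))"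
proof -
  \<comment> \<open>The discretisation costs \<open>exp (\<theta> l / M)\<close> per school, hence
    \<open>exp (\<theta> l / n) \<le> exp 2\<close> in total, because
    \<open>\<theta> l \<le> 1 + n\<close>.\<close>
  define M where "M = n * n"
  have M: "M > 0" using n0 by (simp add: M_def)
  define \<theta> where "\<theta> l = 1 + \<gamma> * real l" for l :: nat
  define L where "L = nat \<lfloor>n / \<gamma>\<rfloor>"
  define q where "q = n * (3 * (1 + \<gamma>) * (k * \<eta>) powr \<delta>) ^ n"
  define c where "c l = (if \<theta> l \<le> 1 / \<eta> then ((1 + \<gamma>)\<^sup>2) ^ n else 0) + q" for l
  define \<rho> where "\<rho> = (1 + \<gamma>)\<^sup>2 * (1 - exp (- (1 / \<eta>)))"
  let ?U = "{..<n} \<rightarrow>\<^sub>E {..<M}"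
  let ?Q = "\<lambda>\<pi>. {sp. sp \<in> profiles n \<and> many_low n k \<delta> sp \<pi>}"
  let ?d = "\<lambda>\<pi> sp s. card {i. i < n \<and> s \<in> above (sp ! i) (\<pi> i)}"
  let ?y = "\<lambda>u s. 1 - real (u s) / real M"
  have q0: "q \<ge> 0" using pos by (simp add: q_def)
  have c0: "c l \<ge> 0" for l using q0 by (simp add: c_def)
  have \<theta>1: "\<theta> l \<ge> 1" for l using pos by (simp add: \<theta>_def)
  have \<theta>_le: "\<theta> l \<le> 1 + n" if "l \<le> L" for l
  proof -
    have "real l \<le> n / \<gamma>" using that pos unfolding L_def by (simp add: le_nat_floor le_nat_iff le_floor_iff)
    then show ?thesis using pos by (simp add: \<theta>_def field_simps)
  qed
  have per_u: "(\<Sum>sp\<in>?Q \<pi>. \<Prod>s<n. ?y u s ^ ?d \<pi> sp s)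
      \<le> fact (n - 1) ^ n * (\<Sum>l\<le>L. c l * (exp 1 * (\<theta> l * exp (- \<theta> l * ((\<Sum>j<n. real (u j) / M) / n)))) ^ n)"
    if \<pi>: "\<pi> permutes {0..<n}" and u: "u \<in> ?U" for \<pi> u
  proof -
    have "(\<Sum>sp\<in>?Q \<pi>. \<Prod>s<n. ?y u s ^ ?d \<pi> sp s)
        = (\<Sum>sp\<in>?Q \<pi>. \<Prod>i<n. \<Prod>s\<in>above (sp ! i) (\<pi> i). ?y u s)"
    proof (rule sum.cong[OF refl], rule prod_power_card_swap)
      fix sp i assume "sp \<in> ?Q \<pi>" "i < n"
      then have "sp ! i \<in> permutations_of_set {0..<n}" using profiles_nth by blast
      then show "above (sp ! i) (\<pi> i) \<subseteq> {..<n}"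
        using above_subset[of "sp ! i" "\<pi> i"] by (auto simp: permutations_of_set_def)
    qed
    also have "\<dots> \<le> fact (n - 1) ^ n * (\<Sum>l\<le>L. c l *
        (exp 1 * (\<theta> l * exp (- \<theta> l * ((\<Sum>j<n. 1 - ?y u j) / n)))) ^ n)"
      unfolding c_def q_def \<theta>_def L_def
    proof (rule sum_profiles_many_low_grid_le[OF \<pi> _ pos k\<eta> n_big])
      fix s assume "s < n"
      then have "u s < M" using u by auto
      then show "0 \<le> ?y u s \<and> ?y u s \<le> 1" using M by simp
    qed
    finally show ?thesis by simp
  qed
  \<comment> \<open>For fixed \<open>l\<close> the function \<open>u\<close> enters through a sum
    over schools in the exponent, so the average factorizes into \<open>n\<close> equal Riemann
    sums.\<close>
  have per_l: "(\<Sum>u\<in>?U. (\<theta> l * exp (- \<theta> l * ((\<Sum>j<n. real (u j) / M) / n))) ^ n) / real M ^ n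
      \<le> (1 - exp (- \<theta> l)) ^ n * exp 2" if "l \<le> L" for l
  proof -
    let ?t = "\<theta> l"
    have t1: "?t \<ge> 1" by (rule \<theta>1)
    have "(?t * exp (- ?t * ((\<Sum>j<n. real (u j) / M) / n))) ^ n = (\<Prod>j<n. ?t * exp (- ?t * real (u j) / M))" for u :: "nat \<Rightarrow> nat"
    proof -
      let ?S = "\<Sum>j<n. real (u j) / M"
      have "exp (- ?t * (?S / n)) ^ n = exp (real n * (- ?t * (?S / n)))"
        by (rule exp_of_nat_mult[symmetric])
      also have "real n * (- ?t * (?S / n)) = - ?t * ?S" using n0 by simp
      also have "\<dots> = (\<Sum>j<n. - ?t * real (u j) / M)"
        by (simp only: sum_distrib_left times_divide_eq_right)
      finally have "exp (- ?t * (?S / n)) ^ n = exp (\<Sum>j<n. - ?t * real (u j) / M)" .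
      then show ?thesis by (simp add: power_mult_distrib prod.distrib exp_sum)
    qed
    then have "(\<Sum>u\<in>?U. (?t * exp (- ?t * ((\<Sum>j<n. real (u j) / M) / n))) ^ n)
        = (\<Sum>u\<in>?U. \<Prod>j<n. ?t * exp (- ?t * real (u j) / M))"
      by simp
    also have "\<dots> = (\<Prod>j<n. \<Sum>v<M. ?t * exp (- ?t * real v / M))"
      by (rule prod_sum_PiE[symmetric]) auto
    also have "\<dots> = (?t * (\<Sum>v<M. exp (- ?t * real v / M))) ^ n"
      by (simp add: sum_distrib_left)
    finally have "(\<Sum>u\<in>?U. (?t * exp (- ?t * ((\<Sum>j<n. real (u j) / M) / n))) ^ n) / real M ^ n
        = (?t * (\<Sum>v<M. exp (- ?t * real v / M)) / M) ^ n"
      by (simp add: power_divide)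
    also have "\<dots> \<le> ((1 - exp (- ?t)) * exp (?t / M)) ^ n"
      using t1 M by (intro power_mono sum_exp_grid_le divide_nonneg_nonneg mult_nonneg_nonneg sum_nonneg) auto
    also have "\<dots> = (1 - exp (- ?t)) ^ n * exp (?t / n)"
      using n0 by (simp add: power_mult_distrib exp_of_nat_mult[symmetric] M_def)
    also have "\<dots> \<le> (1 - exp (- ?t)) ^ n * exp 2"
    proof (intro mult_left_mono)
      have "?t \<le> 2 * n" using \<theta>_le[OF that] n0 by linarith
      then show "exp (?t / n) \<le> exp 2" using n0 by (simp add: divide_le_eq)
    qed (use t1 in simp)
    finally show ?thesis .
  qed
  \<comment> \<open>The factor \<open>((1 + \<gamma>)\<^sup>2) ^ n\<close> occurs only for
    \<open>\<theta> l \<le> 1 / \<eta>\<close>, where \<open>1 - exp (- \<theta> l)\<close> is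
    bounded away from 1; the second term is small by itself.\<close>
  have c_le: "c l * (1 - exp (- \<theta> l)) ^ n \<le> \<rho> ^ n + q" for l
  proof -
    let ?e = "(1 - exp (- \<theta> l)) ^ n"
    have e: "0 \<le> ?e" "?e \<le> 1" using \<theta>1[of l] by (auto intro: power_le_one)
    have "q * ?e \<le> q" using e q0 by (simp add: mult_left_le)
    moreover have "(if \<theta> l \<le> 1 / \<eta> then ((1 + \<gamma>)\<^sup>2) ^ n else 0) * ?e \<le> \<rho> ^ n"
    proof (cases "\<theta> l \<le> 1 / \<eta>")
      case True
      have "?e \<le> (1 - exp (- (1 / \<eta>))) ^ n" using True \<theta>1[of l] by (intro power_mono) auto
      then show ?thesis using True by (simp add: \<rho>_def power_mult_distrib mult_left_mono)
    next
      case False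
      then show ?thesis using pos by (simp add: \<rho>_def)
    qed
    ultimately show ?thesis by (simp add: c_def distrib_right)
  qed
  have per_\<pi>: "(\<Sum>sp\<in>?Q \<pi>. \<Prod>s<n. fact n / (1 + real (?d \<pi> sp s)))
      \<le> fact n ^ n * (fact (n - 1) ^ n * (exp (real n) * ((n / \<gamma> + 1) * ((\<rho> ^ n + q) * exp 2))))"
    if \<pi>: "\<pi> permutes {0..<n}" for \<pi>
  proof -
    let ?E = "\<lambda>u l. \<theta> l * exp (- \<theta> l * ((\<Sum>j<n. real (u j) / M) / n))"
    have out: "(\<Sum>sp\<in>?Q \<pi>. \<Prod>s<n. fact n / (1 + real (?d \<pi> sp s)))
        = fact n ^ n * (\<Sum>sp\<in>?Q \<pi>. \<Prod>s<n. 1 / (1 + real (?d \<pi> sp s)))"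
      by (simp add: prod_dividef sum_distrib_left)
    have "(\<Sum>sp\<in>?Q \<pi>. \<Prod>s<n. 1 / (1 + real (?d \<pi> sp s)))
        \<le> (\<Sum>sp\<in>?Q \<pi>. (\<Sum>u\<in>?U. \<Prod>s<n. ?y u s ^ ?d \<pi> sp s) / real M ^ n)"
      by (intro sum_mono prod_inverse_Suc_le M)
    also have "\<dots> = (\<Sum>sp\<in>?Q \<pi>. \<Sum>u\<in>?U. \<Prod>s<n. ?y u s ^ ?d \<pi> sp s) / real M ^ n"
      by (rule sum_divide_distrib[symmetric])
    also have "\<dots> = (\<Sum>u\<in>?U. \<Sum>sp\<in>?Q \<pi>. \<Prod>s<n. ?y u s ^ ?d \<pi> sp s) / real M ^ n"
      by (subst sum.swap) (rule refl)
    also have "\<dots> \<le> (\<Sum>u\<in>?U. fact (n - 1) ^ n * (\<Sum>l\<le>L. c l * (exp 1 * ?E u l) ^ n)) / real M ^ n"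
      by (intro divide_right_mono sum_mono per_u \<pi>) auto
    also have "\<dots> = fact (n - 1) ^ n * (exp (real n) * (\<Sum>l\<le>L. c l * ((\<Sum>u\<in>?U. ?E u l ^ n) / real M ^ n)))"
    proof -
      have "exp (1 :: real) ^ n = exp (real n)" by (simp add: exp_of_nat_mult[symmetric])
      then have "c l * (exp 1 * ?E u l) ^ n = exp (real n) * (c l * ?E u l ^ n)" for u l
        by (simp add: power_mult_distrib)
      then have "(\<Sum>u\<in>?U. fact (n - 1) ^ n * (\<Sum>l\<le>L. c l * (exp 1 * ?E u l) ^ n))
          = fact (n - 1) ^ n * (exp (real n) * (\<Sum>u\<in>?U. \<Sum>l\<le>L. c l * ?E u l ^ n))"
        by (simp only: sum_distrib_left)
      also have "(\<Sum>u\<in>?U. \<Sum>l\<le>L. c l * ?E u l ^ n) = (\<Sum>l\<le>L. c l * (\<Sum>u\<in>?U. ?E u l ^ n))"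
        by (subst sum.swap) (simp only: sum_distrib_left)
      finally show ?thesis by (simp only: sum_divide_distrib[symmetric] times_divide_eq_right)
    qed
    also have "\<dots> \<le> fact (n - 1) ^ n * (exp (real n) * (\<Sum>l\<le>L. c l * ((1 - exp (- \<theta> l)) ^ n * exp 2)))"
      using c0 by (intro mult_left_mono sum_mono per_l) auto
    also have "\<dots> \<le> fact (n - 1) ^ n * (exp (real n) * (\<Sum>l\<le>L. (\<rho> ^ n + q) * exp 2))"
      using c_le by (intro mult_left_mono sum_mono) (auto simp: mult.assoc[symmetric] mult_right_mono)
    also have "\<dots> = fact (n - 1) ^ n * (exp (real n) * (real (L + 1) * ((\<rho> ^ n + q) * exp 2)))"
      by simp
    also have "\<dots> \<le> fact (n - 1) ^ n * (exp (real n) * ((n / \<gamma> + 1) * ((\<rho> ^ n + q) * exp 2)))"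
    proof (intro mult_left_mono mult_right_mono)
      show "real (L + 1) \<le> n / \<gamma> + 1" unfolding L_def using pos by (simp add: of_nat_floor)
      show "0 \<le> (\<rho> ^ n + q) * exp 2" using q0 pos by (simp add: \<rho>_def)
    qed auto
    finally show ?thesis unfolding out by (intro mult_left_mono) auto
  qed
  let ?B = "(n / \<gamma> + 1) * ((\<rho> ^ n + q) * exp 2)"
  have B0: "?B \<ge> 0" using q0 pos by (simp add: \<rho>_def)
  have "real (card {P\<in>problems n. many_low n k \<delta> (fst P) (DA n P)})
      \<le> (\<Sum>\<pi> | \<pi> permutes {0..<n}. \<Sum>sp\<in>?Q \<pi>. \<Prod>s<n. fact n / (1 + real (?d \<pi> sp s)))"
    by (rule card_many_low_le)
  also have "\<dots> \<le> (\<Sum>\<pi> | \<pi> permutes {0..<n}. fact n ^ n * (fact (n - 1) ^ n * (exp (real n) * ?B)))"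
    by (intro sum_mono per_\<pi>) simp
  also have "\<dots> = fact n ^ n * (fact (n - 1) ^ n * ((fact n * exp (real n)) * ?B))"
    by (simp add: card_permutations[of _ n])
  \<comment> \<open>The \<open>n!\<close> matchings and the factor \<open>exp n\<close> together
    give \<open>n ^ n\<close> up to a linear factor, which completes \<open>fact (n - 1) ^ n\<close>
    to \<open>fact n ^ n\<close>: all exponential growth cancels against the number of
    problems.\<close>
  also have "\<dots> \<le> fact n ^ n * (fact (n - 1) ^ n * ((exp 1 * real n * real n ^ n) * ?B))"
    using fact_le_exp[OF n0] B0 by (intro mult_left_mono mult_right_mono) auto
  also have "\<dots> = fact n ^ n * ((real n * fact (n - 1)) ^ n * (exp 1 * real n * ?B))"
    by (simp add: power_mult_distrib)
  also have "real n * fact (n - 1) = fact n" using n0 by (simp add: fact_reduce)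
  also have "exp 1 * real n * ?B = exp 3 * n * (n / \<gamma> + 1) * (\<rho> ^ n + q)"
  proof -
    have "exp (3 :: real) = exp 1 * exp 2" by (simp add: exp_add[symmetric])
    then show ?thesis by simp
  qed
  finally show ?thesis by (simp add: card_problems \<rho>_def q_def mult.assoc)
qed

section \<open>Size of cycle packings\<close>

text \<open>A student of \<open>A\<close> whose match is not among her first \<open>k\<close>
  choices prefers all of these to her match; envying nobody in \<open>W - A\<close>, she has none of
  the schools of \<open>W - A\<close> among them. So either \<open>\<delta> * n\<close> such
  students avoid \<open>T\<close>, or the others in \<open>A\<close> number at least
  \<open>\<delta> * n\<close>.\<close>

lemma uncovered_envy_cases:
  fixes \<delta> :: real
  assumes P: "P \<in> problems n" and H: "cycle_packing {0..<n} (envy n P) H"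
    and few: "real (card (cover H)) < (1 - 4 * \<delta>) * n" and \<delta>n: "1 \<le> \<delta> * n"
  shows "many_low n k \<delta> (fst P) (DA n P) \<or>
    (\<exists>A\<subseteq>{0..<n}. \<exists>T\<subseteq>{0..<n}. \<delta> * n \<le> card A \<and> \<delta> * n \<le> card T \<and>
            (\<forall>i\<in>A. set (take k (fst P ! i)) \<inter> T = {}))"
proof (rule disjCI)
  assume not_avoid: "\<not> (\<exists>A\<subseteq>{0..<n}. \<exists>T\<subseteq>{0..<n}. \<delta> * n \<le> card A \<and> \<delta> * n \<le> card T \<and>
            (\<forall>i\<in>A. set (take k (fst P ! i)) \<inter> T = {}))"
  define W where "W = {0..<n} - cover H"
  have cover_sub: "cover H \<subseteq> {0..<n}"
    using H unfolding cycle_packing_def is_cycle_def cover_def by auto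
  have finW: "finite W" by (simp add: W_def)
  have "card W = n - card (cover H)"
    unfolding W_def using cover_sub by (simp add: card_Diff_subset finite_subset)
  moreover have "card (cover H) \<le> n" using card_mono[OF _ cover_sub] by simp
  ultimately have cardW: "real (card W) > 4 * \<delta> * n" using few by (simp add: of_nat_diff algebra_simps)
  \<comment> \<open>Of more than \<open>4 * \<delta> * n\<close> uncovered students about half go to
    \<open>A\<close>. The rounding error of at most 1 is absorbed by
    \<open>1 \<le> \<delta> * n\<close>, so at least \<open>\<delta> * n\<close> remain outside
    \<open>A\<close>.\<close>
  define m where "m = nat \<lceil>2 * \<delta> * n\<rceil>"
  have m: "2 * \<delta> * n \<le> m" "m \<le> 2 * \<delta> * n + 1" using \<delta>n unfolding m_def by linarith+
  then have m_le: "m \<le> card W" using cardW \<delta>n by linarith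
  obtain A where A: "A \<subseteq> W" "card A = m" and no_edge: "\<forall>a\<in>A. \<forall>b\<in>W - A. \<not> envy n P a b"
    using acyclic_split[OF finW _ m_le, of "envy n P"] H unfolding cycle_packing_def W_def by blast
  have finA: "finite A" using A finW finite_subset by blast
  define T where "T = DA n P ` (W - A)"
  have bij: "bij_betw (DA n P) {0..<n} {0..<n}" by (rule DA_bij[OF P])
  have WA: "W - A \<subseteq> {0..<n}" by (auto simp: W_def)
  have "card T = card (W - A)"
    unfolding T_def using bij WA by (intro card_image) (auto simp: bij_betw_def intro: inj_on_subset)
  also have "\<dots> = card W - m" using A finA by (simp add: card_Diff_subset)
  finally have cT: "\<delta> * n \<le> card T" using m m_le cardW \<delta>n by (simp add: of_nat_diff)
  have T_sub: "T \<subseteq> {0..<n}" unfolding T_def using bij WA by (auto simp: bij_betw_def)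
  define X where "X = {i. i < n \<and> rank_of (fst P ! i) (DA n P i) < k}"
  have "set (take k (fst P ! i)) \<inter> T = {}" if i: "i \<in> A - X" for i
  proof (rule ccontr)
    assume "set (take k (fst P ! i)) \<inter> T \<noteq> {}"
    then obtain j where j: "j \<in> W - A" "DA n P j \<in> set (take k (fst P ! i))" by (auto simp: T_def)
    have i_n: "i < n" using i A by (auto simp: W_def)
    then have "k \<le> rank_of (fst P ! i) (DA n P i)" using i by (auto simp: X_def)
    from set_take_subset_set_take[OF this, of "fst P ! i"] have "DA n P j \<in> above (fst P ! i) (DA n P i)"
      using j(2) by (auto simp: above_eq_take)
    moreover have "distinct (fst P ! i)" "DA n P i \<in> set (fst P ! i)"
      using problems_nth(1)[OF P i_n] bij i_n by (auto simp: permutations_of_set_def bij_betw_def)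
    ultimately have "envy n P i j"
      using i_n j(1) WA by (auto simp: envy_def prefers_iff_above)
    then show False using no_edge i j(1) by blast
  qed
  moreover have "A - X \<subseteq> {0..<n}" using A by (auto simp: W_def)
  ultimately have "\<not> \<delta> * n \<le> card (A - X)" using not_avoid cT T_sub by blast
  moreover have "card A - card X \<le> card (A - X)" by (rule diff_card_le_card_Diff) (simp add: X_def)
  ultimately have "\<delta> * n \<le> card X" using A m by linarith
  then show "many_low n k \<delta> (fst P) (DA n P)" by (simp add: many_low_def X_def)
qed

text \<open>The cube root of \<open>r\<close> reduces the claim to the limit of
  \<open>n * x ^ n\<close>.\<close>

lemma cube_times_power_tendsto_0:
  fixes r :: real
  assumes "0 < r" "r < 1"
  shows "(\<lambda>n. real n ^ 3 * r ^ n) \<longlonglongrightarrow> 0"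
proof -
  let ?x = "root 3 r"
  have "norm ?x < 1" using assms by simp
  then have "(\<lambda>n. real n * ?x ^ n) \<longlonglongrightarrow> 0" by (rule powser_times_n_limit_0)
  then have "(\<lambda>n. (real n * ?x ^ n) ^ 3) \<longlonglongrightarrow> 0 ^ 3" by (rule tendsto_power)
  moreover have "(?x ^ n) ^ 3 = r ^ n" for n
  proof -
    have "(?x ^ n) ^ 3 = (?x ^ 3) ^ n" by (simp add: power_mult[symmetric] mult.commute)
    then show ?thesis using assms by simp
  qed
  ultimately show ?thesis by (simp add: power_mult_distrib)
qed

theorem theorem2:
  fixes \<epsilon> :: real
  assumes "\<epsilon> > 0"
  shows "(\<lambda>n. real (card {P \<in> problems n. \<forall>H. cycle_packing {0..<n} (envy n P) H \<longrightarrow>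
                  real (card (cover H)) \<ge> (1 - \<epsilon>) * real n})
             / real (card (problems n))) \<longlonglongrightarrow> 1"
proof -
  \<comment> \<open>The constants are fixed in the order \<open>\<delta>\<close>, \<open>k\<close>,
    \<open>\<eta>\<close>, \<open>\<gamma>\<close>, each depending on the earlier ones. The minimum
    with 1 keeps \<open>\<delta> < 1\<close> also for large \<open>\<epsilon>\<close>.\<close>
  define \<delta> where "\<delta> = min \<epsilon> 1 / 4"
  have \<delta>: "0 < \<delta>" "\<delta> < 1" "4 * \<delta> \<le> \<epsilon>" using assms by (auto simp: \<delta>_def)
  have "(\<lambda>k. (1 - \<delta>) ^ k) \<longlonglongrightarrow> 0" using \<delta> by (intro LIMSEQ_realpow_zero) auto
  \<comment> \<open>The threshold makes \<open>((1 - \<delta>) ^ k) powr \<delta>\<close> at most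
    \<open>1 / 8\<close>, so that the factor 4 from the union bound leaves the base
    \<open>1 / 2\<close>.\<close>
  then have "\<forall>\<^sub>F k in sequentially. (1 - \<delta>) ^ k < (1 / 8) powr (1 / \<delta>)"
    by (rule order_tendstoD) simp
  then obtain k where k: "k > 0" "(1 - \<delta>) ^ k < (1 / 8) powr (1 / \<delta>)"
    using eventually_gt_at_top[of 0] by (metis (mono_tags, lifting) eventually_elim2 eventually_happens trivial_limit_sequentially eventually_conj)
  have "((1 - \<delta>) ^ k) powr \<delta> \<le> ((1 / 8) powr (1 / \<delta>)) powr \<delta>"
    using k \<delta> by (intro powr_mono2) auto
  also have "\<dots> = 1 / 8" using \<delta> by (simp add: powr_powr)
  finally have k_half: "4 * ((1 - \<delta>) ^ k) powr \<delta> \<le> 1 / 2" by simp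
  \<comment> \<open>This gives \<open>(k * \<eta>) powr \<delta> = 1 / 12\<close>, hence the base
    \<open>3 * (1 + \<gamma>) / 12 \<le> 1 / 2\<close> for \<open>\<gamma> \<le> 1\<close>.\<close>
  define \<eta> where "\<eta> = (1 / 12) powr (1 / \<delta>) / k"
  have \<eta>: "\<eta> > 0" using k by (simp add: \<eta>_def)
  have k\<eta>_eq: "k * \<eta> = (1 / 12) powr (1 / \<delta>)" using k by (simp add: \<eta>_def)
  have k\<eta>: "k * \<eta> \<le> 1" unfolding k\<eta>_eq using \<delta> by (intro powr_le1) auto
  have k\<eta>_powr: "(k * \<eta>) powr \<delta> = 1 / 12" unfolding k\<eta>_eq using \<delta> by (simp add: powr_powr)
  define e where "e = exp (- (1 / \<eta>))"
  have e: "0 < e" "e < 1" using \<eta> by (auto simp: e_def)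
  \<comment> \<open>Small enough for \<open>(1 + \<gamma>)\<^sup>2 \<le> 1 + e\<close>, which yields
    \<open>\<rho> \<le> 1 - e\<^sup>2 < 1\<close>.\<close>
  define \<gamma> where "\<gamma> = e / 3"
  have \<gamma>: "0 < \<gamma>" "\<gamma> \<le> 1" using e by (auto simp: \<gamma>_def)
  define \<rho> where "\<rho> = (1 + \<gamma>)\<^sup>2 * (1 - e)"
  define r where "r = max (1 / 2) (1 - e\<^sup>2)"
  have r: "0 < r" "r < 1" using e by (auto simp: r_def)
  have "(1 + \<gamma>)\<^sup>2 \<le> 1 + e"
  proof -
    have "\<gamma> * \<gamma> \<le> \<gamma> * 1" using \<gamma> by (intro mult_left_mono) auto
    then show ?thesis by (simp add: power2_eq_square algebra_simps \<gamma>_def)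
  qed
  then have "\<rho> \<le> (1 + e) * (1 - e)" unfolding \<rho>_def using e by (intro mult_right_mono) auto
  also have "\<dots> \<le> r" by (simp add: r_def algebra_simps power2_eq_square)
  finally have \<rho>r: "\<rho> \<le> r" .
  have \<rho>0: "\<rho> \<ge> 0" using e by (simp add: \<rho>_def)
  define p where "p n = real (card {P \<in> problems n. \<forall>H. cycle_packing {0..<n} (envy n P) H \<longrightarrow>
                  real (card (cover H)) \<ge> (1 - \<epsilon>) * real n}) / real (card (problems n))" for n
  define C where "C = 1 + exp 3 * (1 / \<gamma> + 1) * 2"
  have upper: "p n \<le> 1" for n
  proof -
    have "finite (problems n)" using finite_profiles by (simp add: problems_eq)
    then have "real (card {P \<in> problems n. \<forall>H. cycle_packing {0..<n} (envy n P) H \<longrightarrow>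
                  real (card (cover H)) \<ge> (1 - \<epsilon>) * real n}) \<le> card (problems n)"
      by (intro of_nat_mono card_mono) auto
    then show ?thesis unfolding p_def by (simp add: card_problems divide_le_eq)
  qed
  have lower: "1 - C * (real n ^ 3 * r ^ n) \<le> p n"
    if n: "real n \<ge> max (real k) (max ((1 + \<gamma>) / (\<gamma> * \<eta>)) (1 / \<delta>))" "n > 0" for n
  proof -
    let ?G = "{P \<in> problems n. \<forall>H. cycle_packing {0..<n} (envy n P) H \<longrightarrow>
                  real (card (cover H)) \<ge> (1 - \<epsilon>) * real n}"
    let ?X = "{P\<in>problems n. \<exists>A\<subseteq>{0..<n}. \<exists>T\<subseteq>{0..<n}. \<delta> * n \<le> card A \<and> \<delta> * n \<le> card T \<and>
            (\<forall>i\<in>A. set (take k (fst P ! i)) \<inter> T = {})}"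
    let ?Y = "{P\<in>problems n. many_low n k \<delta> (fst P) (DA n P)}"
    let ?N = "real (card (problems n))"
    have fin: "finite (problems n)" using finite_profiles by (simp add: problems_eq)
    have Npos: "?N > 0" by (simp add: card_problems)
    have \<delta>n: "1 \<le> \<delta> * n" using n \<delta> by (simp add: field_simps)
    have "problems n \<subseteq> ?G \<union> (?X \<union> ?Y)"
    proof
      fix P assume P: "P \<in> problems n"
      show "P \<in> ?G \<union> (?X \<union> ?Y)"
      proof (cases "P \<in> ?G")
        case False
        then obtain H where H: "cycle_packing {0..<n} (envy n P) H" "real (card (cover H)) < (1 - \<epsilon>) * n"
          using P by auto
        have "(1 - \<epsilon>) * n \<le> (1 - 4 * \<delta>) * n" using \<delta> by (intro mult_right_mono) auto
        then show ?thesis using uncovered_envy_cases[OF P H(1) _ \<delta>n, of k] H(2) P by auto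
      qed simp
    qed
    then have "card (problems n) \<le> card (?G \<union> (?X \<union> ?Y))" using fin by (intro card_mono) auto
    also have "\<dots> \<le> card ?G + (card ?X + card ?Y)"
      by (meson card_Un_le add_left_mono order_trans)
    finally have cards: "?N \<le> real (card ?G) + (real (card ?X) + real (card ?Y))"
      by (simp flip: of_nat_add)
    have n1: "1 \<le> real n ^ 3" using n by simp
    have half: "(1 / 2) ^ n \<le> r ^ n" by (intro power_mono) (auto simp: r_def)
    have rn0: "0 \<le> r ^ n" using r by simp
    have "real (card ?X) \<le> ?N * (4 * ((1 - \<delta>) ^ k) powr \<delta>) ^ n"
      using n \<delta> by (intro card_avoiding_problems_le) auto
    also have "\<dots> \<le> ?N * (1 / 2) ^ n"
      using k_half by (intro mult_left_mono power_mono) auto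
    also have "\<dots> \<le> ?N * (real n ^ 3 * r ^ n)"
    proof (intro mult_left_mono)
      have "1 * r ^ n \<le> real n ^ 3 * r ^ n" using n1 rn0 by (intro mult_right_mono)
      then show "(1 / 2) ^ n \<le> real n ^ 3 * r ^ n" using half by linarith
    qed simp
    finally have X: "real (card ?X) \<le> ?N * (real n ^ 3 * r ^ n)" .
    let ?q = "3 * (1 + \<gamma>) * (k * \<eta>) powr \<delta>"
    have "?q \<le> 1 / 2" unfolding k\<eta>_powr using \<gamma> by simp
    then have q: "?q ^ n \<le> r ^ n" using \<gamma> by (intro power_mono) (auto simp: r_def)
    have "real (card ?Y) \<le> ?N * (exp 3 * n * (n / \<gamma> + 1) * (\<rho> ^ n + n * ?q ^ n))"
      unfolding \<rho>_def e_def using n \<eta> \<gamma> k k\<eta> by (intro card_many_low_problems_le) auto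
    \<comment> \<open>The three factors \<open>n\<close> come from the elementary Stirling bound,
      the number of grid points, and the one exceptional student.\<close>
    also have "\<dots> \<le> ?N * (exp 3 * n * (n * (1 / \<gamma> + 1)) * (n * (2 * r ^ n)))"
    proof (intro mult_left_mono mult_mono)
      show "n / \<gamma> + 1 \<le> n * (1 / \<gamma> + 1)" using n by (simp add: algebra_simps)
      have "\<rho> ^ n \<le> 1 * r ^ n" using \<rho>r \<rho>0 by (simp add: power_mono)
      also have "\<dots> \<le> n * r ^ n" using n rn0 by (intro mult_right_mono) auto
      finally have "\<rho> ^ n \<le> n * r ^ n" .
      moreover have "n * ?q ^ n \<le> n * r ^ n" using q by (intro mult_left_mono) auto
      ultimately show "\<rho> ^ n + n * ?q ^ n \<le> n * (2 * r ^ n)" by simp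
    qed (use \<rho>0 \<gamma> in auto)
    also have "\<dots> = ?N * (exp 3 * (1 / \<gamma> + 1) * 2 * (real n ^ 3 * r ^ n))"
      by (simp add: power3_eq_cube)
    finally have "real (card ?X) + real (card ?Y) \<le> ?N * (C * (real n ^ 3 * r ^ n))"
      using X by (simp add: C_def distrib_left distrib_right)
    then have "?N * (1 - C * (real n ^ 3 * r ^ n)) \<le> real (card ?G)"
      using cards by (simp add: right_diff_distrib)
    then show ?thesis unfolding p_def using Npos by (simp add: le_divide_eq mult.commute)
  qed
  have "p \<longlonglongrightarrow> 1"
  proof (rule tendsto_sandwich[of "\<lambda>n. 1 - C * (real n ^ 3 * r ^ n)" _ _ "\<lambda>_. 1"])
    have "\<forall>\<^sub>F n in sequentially. real n \<ge> max (real k) (max ((1 + \<gamma>) / (\<gamma> * \<eta>)) (1 / \<delta>))"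
      using filterlim_real_sequentially unfolding filterlim_at_top by blast
    then show "\<forall>\<^sub>F n in sequentially. 1 - C * (real n ^ 3 * r ^ n) \<le> p n"
      using eventually_gt_at_top[of 0] by eventually_elim (rule lower)
    have "(\<lambda>n. 1 - C * (real n ^ 3 * r ^ n)) \<longlonglongrightarrow> 1 - C * 0"
      by (intro tendsto_intros cube_times_power_tendsto_0 r)
    then show "(\<lambda>n. 1 - C * (real n ^ 3 * r ^ n)) \<longlonglongrightarrow> 1" by simp
  qed (use upper in auto)
  then show ?thesis by (simp only: p_def[abs_def])
qed

end
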